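(* Let $P$ be a finite set of at least three points in general position in the plane (no three collinear). Then $$u(P)\le \frac{4}{3}|I(P)|+\frac{1}{3}|B(P)|+1.$$
   Context: For a finite point set $P\subset\mathbb{R}^2$ in general position, ${\rm CH}(P)$ denotes the convex hull of $P$, $B(P)\subseteq P$ denotes the set of points of $P$ that are vertices of ${\rm CH}(P)$, and $I(P)=P\setminus B(P)$. A set $\Pi$ of closed convex polygons with vertices in $P$ and with pairwise disjoint interiors is called a convex decomposition of $P$ if the union of the polygons in $\Pi$ is ${\rm CH}(P)$ and no point of $P$ lies in the interior of any element of $\Pi$. $u(P)$ denotes the minimum number of elements of a convex decomposition of $P$. *)

theory Defs
  imports "HOL-Analysis.Analysis"
begin

definition general_position :: "(real^2) set \<Rightarrow> bool" where
  "general_position P \<longleftrightarrow>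
     (\<forall>a\<in>P. \<forall>b\<in>P. \<forall>c\<in>P. a \<noteq> b \<and> a \<noteq> c \<and> b \<noteq> c \<longrightarrow> \<not> collinear {a, b, c})"

definition vertices :: "(real^2) set \<Rightarrow> (real^2) set" where
  "vertices Q = {x. x extreme_point_of Q}"

definition boundary_points :: "(real^2) set \<Rightarrow> (real^2) set" where
  "boundary_points P = {p \<in> P. p \<in> vertices (convex hull P)}"

definition interior_points :: "(real^2) set \<Rightarrow> (real^2) set" where
  "interior_points P = P - boundary_points P"

text \<open>A closed convex polygon is a solid polytope in the plane; the empty set, points and
  segments are excluded by requiring nonempty interior.\<close>

definition convex_polygon :: "(real^2) set \<Rightarrow> bool" where
  "convex_polygon Q \<longleftrightarrow> polytope Q \<and> interior Q \<noteq> {}"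

definition convex_decomposition :: "(real^2) set \<Rightarrow> (real^2) set set \<Rightarrow> bool" where
  "convex_decomposition P D \<longleftrightarrow>
     (\<forall>Q\<in>D. convex_polygon Q \<and> vertices Q \<subseteq> P) \<and>
     pairwise (\<lambda>Q R. interior Q \<inter> interior R = {}) D \<and>
     \<Union>D = convex hull P \<and>
     (\<forall>Q\<in>D. P \<inter> interior Q = {})"

text \<open>The next lemma ensures that the cardinalities used in \<open>min_decomposition\<close>
  are genuine ones: no decomposition is infinite, which would have \<open>card\<close> equal to 0.\<close>

lemma convex_decomposition_finite:
  assumes "finite P" "convex_decomposition P D"
  shows "finite D"
proof -
  have "D \<subseteq> (\<lambda>V. convex hull V) ` Pow P"
  proof
    fix Q assume "Q \<in> D"
    then have "polytope Q" and V: "vertices Q \<subseteq> P"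
      using assms(2) by (auto simp: convex_decomposition_def convex_polygon_def)
    then have "Q = convex hull (vertices Q)"
      unfolding vertices_def
      by (intro Krein_Milman_Minkowski polytope_imp_compact polytope_imp_convex)
    with V show "Q \<in> (\<lambda>V. convex hull V) ` Pow P" by blast
  qed
  then show ?thesis
    using assms(1) by (meson finite_Pow_iff finite_imageI finite_subset)
qed

text \<open>If there were no decomposition, this \<open>LEAST\<close> would be unspecified, so an upper bound on
  it can only be proved by exhibiting a decomposition.\<close>

definition min_decomposition :: "(real^2) set \<Rightarrow> nat" where
  "min_decomposition P = (LEAST n. \<exists>D. convex_decomposition P D \<and> card D = n)"

end

theory Submission
  imports Defs
begin

text \<open>The decomposition is built around one vertex of the convex hull. Put it at the origin and sort the
other \<open>n - 1\<close> points by angle; they lie in an open half-plane, so the order is linear. A \<open>chain\<close> is a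
list of points in this order, and \<open>under L\<close> is the star-shaped region between the origin and the
polygonal line through \<open>L\<close>. An inner vertex of a chain is a valley (\<open>turn\<close> negative) if it is closer
to the origin than the segment between its two neighbours, and a peak otherwise.

The region under a bottom chain is cut into convex pieces by the segments from the origin to its
valleys; this takes one piece more than there are valleys (\<open>partition_slabs\<close>). Then the chain is
pushed outwards: a stretch with only valleys can be replaced by a stretch with the same ends and only
peaks, and the region between the two is one convex polygon (\<open>partition_step\<close>). When no valley is
left, the region under the chain is the convex hull. Cutting off one valley by a triangle adds one
piece and removes one vertex, so the relevant quantity is the number of pieces plus the length of the
chain. The last chain has at least \<open>\<bar>B\<bar> - 1\<close> vertices, hence the theorem follows once that sum is at
most \<open>4 n / 3\<close> (\<open>hull_partition\<close>).

Start with the chain of all \<open>n - 1\<close> points. Removing each maximal run of valleys by one polygon leads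
to the chain of its peaks, with sum \<open>n + R\<close>, where \<open>R\<close> is the number of runs. Since \<open>R\<close> can
be close to \<open>n / 2\<close>, two further savings are needed.

\<^item> Consecutive valleys of the chain of peaks are again removed together. Compared with triangles this
  saves one for each pair of neighbouring valleys (\<open>merge_valleys\<close>).

\<^item> Suppose that all peaks between two successive runs of valleys are still peaks in the chain of
  peaks. Then the bottom chain can skip these peaks and go directly from the last point \<open>a\<close> of the
  first run to the first point \<open>b\<close> of the second one. If \<open>a\<close> and \<open>b\<close> remain valleys, a single
  polygon replaces the polygons above the two runs; each of them that ceases to be a valley costs one
  more polygon but needs no cut from the origin. In every case one piece is saved
  (\<open>bypass_partition\<close>).

The two savings do not interfere, because the first one takes place above the chain of peaks and the
second one below it. Two bypasses interfere only if they use the same run of valleys. What remains is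
a statement about sequences of gaps and signs: a scan from left to right that takes a bypass whenever
the preceding run is still available saves enough (\<open>gap_scan\<close>). Short runs are the critical case: if
valleys and peaks alternate, a peak that gives no bypass is a valley of the chain of peaks, and two
such peaks in a row give a saving of the first kind.\<close>

section \<open>Orientation and chains around the origin\<close>

type_synonym pt = "real^2"

definition det2 :: "pt \<Rightarrow> pt \<Rightarrow> real" where
  "det2 a b = a$1 * b$2 - a$2 * b$1"

text \<open>Twice the signed area of the triangle \<open>a b c\<close>, written in terms of determinants with the origin:
  for \<open>a\<close>, \<open>b\<close>, \<open>c\<close> in angular order it is positive exactly if \<open>b\<close> lies beyond the segment \<open>a c\<close> as seen
  from the origin.\<close>

definition turn :: "pt \<Rightarrow> pt \<Rightarrow> pt \<Rightarrow> real" where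
  "turn a b c = det2 a b + det2 b c - det2 a c"

lemma det2_simps [simp]: "det2 a a = 0" "det2 0 a = 0" "det2 a 0 = 0"
  by (simp_all add: det2_def)

lemma det2_swap: "det2 b a = - det2 a b"
  by (simp add: det2_def)

lemma det2_lin:
  "det2 a (x + y) = det2 a x + det2 a y" "det2 (x + y) a = det2 x a + det2 y a"
  "det2 a (k *\<^sub>R x) = k * det2 a x" "det2 (k *\<^sub>R x) a = k * det2 x a"
  by (simp_all add: det2_def algebra_simps)

text \<open>Cramer's rule: the coordinates of \<open>z\<close> in the basis \<open>a\<close>, \<open>b\<close> are \<open>det2 z b\<close> and \<open>det2 a z\<close>, up
  to the common factor \<open>det2 a b\<close>. Points of the cone over an edge are treated in these coordinates.\<close>

lemma three_term: "det2 a b *\<^sub>R z = det2 z b *\<^sub>R a + det2 a z *\<^sub>R b"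
  by (simp add: vec_eq_iff forall_2 det2_def algebra_simps)

text \<open>The two exchange identities are the Grassmann--Pluecker relations behind the transitivity of
  convexity: four points whose two consecutive triples turn the same way turn that way in all triples.\<close>

lemma turn_exchange_right: "turn a c d * det2 b c = det2 c d * turn a b c + det2 a c * turn b c d"
  by (simp add: turn_def det2_def algebra_simps)

lemma turn_exchange_left: "turn a b d * det2 b c = det2 b d * turn a b c + det2 a b * turn b c d"
  by (simp add: turn_def det2_def algebra_simps)

lemma turn_eq_det2: "turn a b c = det2 (b - a) (c - a)"
  by (simp add: turn_def det2_def algebra_simps)

lemma det2_zero_iff: "det2 a b = 0 \<longleftrightarrow> collinear {0, a, b}"
proof
  assume h: "det2 a b = 0"
  show "collinear {0, a, b}"
  proof (cases "a = 0")
    case False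
    then have "a$1 \<noteq> 0 \<or> a$2 \<noteq> 0"
      by (auto simp: vec_eq_iff forall_2)
    then have "\<exists>k. b = k *\<^sub>R a"
    proof
      assume "a$1 \<noteq> 0"
      then have "b = (b$1 / a$1) *\<^sub>R a"
        using h by (simp add: vec_eq_iff forall_2 det2_def field_simps)
      then show ?thesis by blast
    next
      assume "a$2 \<noteq> 0"
      then have "b = (b$2 / a$2) *\<^sub>R a"
        using h by (simp add: vec_eq_iff forall_2 det2_def field_simps)
      then show ?thesis by blast
    qed
    then show ?thesis by (simp add: collinear_lemma)
  qed (simp add: collinear_lemma)
next
  assume "collinear {0, a, b}"
  then show "det2 a b = 0"
    by (auto simp: collinear_lemma det2_def)
qed

lemma turn_zero_iff: "turn a b c = 0 \<longleftrightarrow> collinear {a, b, c}"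
proof -
  have "collinear {a, b, c} \<longleftrightarrow> collinear {b, a, c}"
    by (simp add: insert_commute)
  also have "\<dots> \<longleftrightarrow> collinear {0, b - a, c - a}"
    by (rule collinear_3) (simp add: NO_MATCH_def)
  finally show ?thesis
    by (simp only: turn_eq_det2 det2_zero_iff)
qed

text \<open>The condition on all pairs, not only on neighbours, makes a chain span less than a half turn.\<close>

definition chain :: "pt list \<Rightarrow> bool" where
  "chain L \<longleftrightarrow> sorted_wrt (\<lambda>a b. 0 < det2 a b) L"

lemma chain_simps [simp]:
  "chain []" "chain (a # L) \<longleftrightarrow> (\<forall>b\<in>set L. 0 < det2 a b) \<and> chain L"
  "chain (L @ M) \<longleftrightarrow> chain L \<and> chain M \<and> (\<forall>a\<in>set L. \<forall>b\<in>set M. 0 < det2 a b)"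
  by (auto simp: chain_def sorted_wrt_append)

definition edges :: "pt list \<Rightarrow> (pt \<times> pt) set" where
  "edges L = set (zip L (tl L))"

lemma edges_simps [simp]:
  "edges [] = {}" "edges [a] = {}" "edges (a # b # L) = insert (a, b) (edges (b # L))"
  by (simp_all add: edges_def)

lemma edges_append: "edges (L @ x # M) = edges (L @ [x]) \<union> edges (x # M)"
proof (induction L)
  case (Cons a L)
  then show ?case by (cases L) auto
qed simp

lemma edges_subset: "(a, b) \<in> edges L \<Longrightarrow> a \<in> set L \<and> b \<in> set L"
  by (auto simp: edges_def dest: set_zip_leftD set_zip_rightD list.set_sel(2))
    (metis list.set_sel(2) set_zip_rightD tl_Nil list.set(1) empty_iff)

lemma edges_det2: "chain L \<Longrightarrow> (a, b) \<in> edges L \<Longrightarrow> 0 < det2 a b"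
proof (induction L)
  case (Cons c L)
  then show ?case by (cases L) auto
qed simp

definition wedge :: "pt \<Rightarrow> pt \<Rightarrow> pt \<Rightarrow> bool" where
  "wedge a b z \<longleftrightarrow> 0 \<le> det2 a z \<and> 0 \<le> det2 z b"

text \<open>The union of the triangles spanned by the origin and the edges of \<open>L\<close>. In the cone of an edge, the
  ratio \<open>(det2 a z + det2 z b) / det2 a b\<close> is the linear functional with value \<open>1\<close> on the edge.\<close>

definition under :: "pt list \<Rightarrow> pt set" where
  "under L = {z. \<exists>(a, b)\<in>edges L. wedge a b z \<and> det2 a z + det2 z b \<le> det2 a b}"

lemma under_append: "under (L @ x # M) = under (L @ [x]) \<union> under (x # M)"
  by (auto simp: under_def edges_append[of L x M])

text \<open>The cones over the edges cover the cone between the end points, so a point of that cone can always be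
  tested against a single edge.\<close>

lemma wedge_cover:
  assumes "chain (x # W @ [y])" "wedge x y z"
  shows "\<exists>(a, b)\<in>edges (x # W @ [y]). wedge a b z"
  using assms
proof (induction W arbitrary: x)
  case Nil
  then show ?case by auto
next
  case (Cons w W)
  show ?case
  proof (cases "0 \<le> det2 z w")
    case True
    then show ?thesis using Cons.prems by (auto simp: wedge_def)
  next
    case False
    then have "wedge w y z" using Cons.prems by (auto simp: wedge_def det2_swap[of z w])
    then show ?thesis using Cons.IH[of w] Cons.prems by auto
  qed
qed

lemma wedge_mono:
  assumes "wedge a b z" "0 < det2 a b" "0 \<le> det2 x a" "0 \<le> det2 x b" "0 \<le> det2 a y" "0 \<le> det2 b y"
  shows "wedge x y z"
proof -
  have "det2 a b * det2 x z = det2 z b * det2 x a + det2 a z * det2 x b"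
       "det2 a b * det2 z y = det2 z b * det2 a y + det2 a z * det2 b y"
    by (simp_all add: det2_def algebra_simps)
  then have "0 \<le> det2 a b * det2 x z" "0 \<le> det2 a b * det2 z y"
    using assms unfolding wedge_def by simp_all
  then show ?thesis using assms(2) by (simp add: wedge_def zero_le_mult_iff)
qed

lemma edge_wedge:
  assumes "chain (x # W @ [y])" "(a, b) \<in> edges (x # W @ [y])" "wedge a b z"
  shows "wedge x y z"
proof -
  have "a \<in> set (x # W @ [y])" "b \<in> set (x # W @ [y])"
    using edges_subset[OF assms(2)] by auto
  then have "0 \<le> det2 x a" "0 \<le> det2 x b" "0 \<le> det2 a y" "0 \<le> det2 b y"
    using assms(1) by (auto simp: less_imp_le)
  then show ?thesis
    using wedge_mono[OF assms(3) edges_det2[OF assms(1,2)]] by blast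
qed

lemma under_wedge: "chain (x # W @ [y]) \<Longrightarrow> z \<in> under (x # W @ [y]) \<Longrightarrow> wedge x y z"
  by (auto simp: under_def intro: edge_wedge)

text \<open>With \<open>s = 1\<close> all inner vertices are peaks (a cap), with \<open>s = -1\<close> all are valleys (a cup). Having the sign
  as a parameter lets one proof serve for both.\<close>

fun bent :: "real \<Rightarrow> pt list \<Rightarrow> bool" where
  "bent s (a # b # c # L) \<longleftrightarrow> 0 < s * turn a b c \<and> bent s (b # c # L)"
| "bent s _ \<longleftrightarrow> True"

text \<open>The global form of \<open>bent\<close>: the condition holds for all triples and not only for consecutive ones.\<close>

fun turning :: "real \<Rightarrow> pt list \<Rightarrow> bool" where
  "turning s (a # L) \<longleftrightarrow> sorted_wrt (\<lambda>b c. 0 < s * turn a b c) L \<and> turning s L"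
| "turning s [] \<longleftrightarrow> True"

lemma turn_trans_right:
  assumes "0 < s * turn a b c" "0 < s * turn b c d" "0 < det2 c d" "0 < det2 a c" "0 < det2 b c"
  shows "0 < s * turn a c d"
proof -
  have "(s * turn a c d) * det2 b c = det2 c d * (s * turn a b c) + det2 a c * (s * turn b c d)"
    using arg_cong[OF turn_exchange_right, of "\<lambda>t. s * t" a c d b] by (simp add: algebra_simps)
  then have "0 < (s * turn a c d) * det2 b c"
    using assms by (simp add: add_pos_pos)
  then show ?thesis using assms(5) by (simp add: zero_less_mult_iff)
qed

lemma turn_trans_left:
  assumes "0 < s * turn a b c" "0 < s * turn b c d" "0 < det2 b d" "0 < det2 a b" "0 < det2 b c"
  shows "0 < s * turn a b d"
proof -
  have "(s * turn a b d) * det2 b c = det2 b d * (s * turn a b c) + det2 a b * (s * turn b c d)"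
    using arg_cong[OF turn_exchange_left, of "\<lambda>t. s * t" a b d c] by (simp add: algebra_simps)
  then have "0 < (s * turn a b d) * det2 b c"
    using assms by (simp add: add_pos_pos)
  then show ?thesis using assms(5) by (simp add: zero_less_mult_iff)
qed

lemma sorted_wrt_conj:
  "sorted_wrt P L \<Longrightarrow> sorted_wrt Q L \<Longrightarrow> sorted_wrt (\<lambda>x y. P x y \<and> Q x y) L"
  by (induction L) auto

text \<open>Local convexity implies global convexity. The first vertex turns correctly with its successor \<open>b\<close> and
  any later \<open>v\<close> by transitivity across the second edge, and then with any two later vertices by transitivity
  across \<open>b\<close>.\<close>

lemma bent_turning:
  assumes "chain L" "bent s L"
  shows "turning s L"
  using assms
proof (induction s L rule: bent.induct)
  case (1 s a b c M)
  have ch: "0 < det2 a b" "0 < det2 a c" "\<forall>v\<in>set M. 0 < det2 a v" "0 < det2 b c" "\<forall>v\<in>set M. 0 < det2 b v"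
      "\<forall>v\<in>set M. 0 < det2 c v" "chain (c # M)"
    using 1(2) by auto
  have t: "turning s (b # c # M)" and abc: "0 < s * turn a b c"
    using 1 by simp_all
  have abv: "0 < s * turn a b v" if "v \<in> set (c # M)" for v
  proof (cases "v = c")
    case False
    then have "v \<in> set M" "0 < s * turn b c v" using t that by auto
    then show ?thesis
      using ch abc by (intro turn_trans_left[of s a b c v]) auto
  qed (use abc in simp)
  have "sorted_wrt (\<lambda>v w. 0 < s * turn b v w) (c # M)"
    using t by simp
  then have "sorted_wrt (\<lambda>v w. 0 < s * turn b v w \<and> 0 < det2 v w) (c # M)"
    using ch(7) unfolding chain_def by (rule sorted_wrt_conj)
  then have "sorted_wrt (\<lambda>v w. 0 < s * turn a v w) (c # M)"
  proof (rule sorted_wrt_mono_rel[rotated])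
    fix v w assume vw: "v \<in> set (c # M)" "w \<in> set (c # M)"
      "0 < s * turn b v w \<and> 0 < det2 v w"
    show "0 < s * turn a v w"
      using vw abv[OF vw(1)] ch by (intro turn_trans_right[of s a b v w]) auto
  qed
  then show ?case using t abv by auto
qed auto

section \<open>Chains that bend one way\<close>

lemma turning_edge_turn:
  "turning s (c # L) \<Longrightarrow> (a, b) \<in> edges L \<Longrightarrow> 0 < s * turn c a b"
proof (induction L)
  case (Cons e L)
  then show ?case by (cases L) auto
qed simp

text \<open>Every further vertex forms with the edge a triple of known sign. In terms of lines: a cap lies below the line
  through each of its edges, a cup above it.\<close>

lemma turning_edges:
  assumes "turning s L" "(a, b) \<in> edges L" "v \<in> set L"
  shows "0 \<le> s * (det2 a b - det2 a v - det2 v b)"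
  using assms
proof (induction L)
  case (Cons c L)
  show ?case
  proof (cases L)
    case Nil
    then show ?thesis using Cons.prems by simp
  next
    case L: (Cons d M)
    have t: "turning s L" "sorted_wrt (\<lambda>b c'. 0 < s * turn c b c') L"
      using Cons.prems(1) by simp_all
    consider "(a, b) = (c, d)" | "(a, b) \<in> edges L"
      using Cons.prems(2) L by auto
    then show ?thesis
    proof cases
      case 1
      consider "v = a" | "v = b" | "v \<in> set M" using Cons.prems(3) 1 L by auto
      then show ?thesis
      proof cases
        case 3
        then have "0 < s * turn a b v" using t(2) 1 L by auto
        then show ?thesis by (simp add: turn_def det2_swap[of v b] algebra_simps)
      qed (auto simp: 1)
    next
      case 2
      show ?thesis
      proof (cases "v = c")
        case True
        have "0 < s * turn c a b"
          by (rule turning_edge_turn[OF Cons.prems(1) 2])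
        then show ?thesis using True by (simp add: turn_def det2_swap[of a c] algebra_simps)
      next
        case False
        then show ?thesis using Cons.IH t 2 Cons.prems(3) by auto
      qed
    qed
  qed
qed simp

text \<open>A linear functional that is at least \<open>k > 0\<close> at \<open>x\<close> and \<open>y\<close> is at least \<open>k\<close> at every point of
  their cone beyond the segment \<open>x y\<close>; with \<open>s = -1\<close>, the same for upper bounds and points on the near
  side.\<close>

lemma combination_bound:
  assumes "0 < det2 x y" "wedge x y v"
    "0 \<le> s * (det2 a x + det2 x b - k)" "0 \<le> s * (det2 a y + det2 y b - k)" "0 < k"
    "0 \<le> s * (det2 x v + det2 v y - det2 x y)"
  shows "0 \<le> s * (det2 a v + det2 v b - k)"
proof -
  \<comment> \<open>Cramer's rule for \<open>v\<close>, with the constant \<open>k\<close> distributed over the three nonnegative terms.\<close>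
  have "det2 x y * (s * (det2 a v + det2 v b - k)) =
      det2 v y * (s * (det2 a x + det2 x b - k)) + det2 x v * (s * (det2 a y + det2 y b - k))
      + k * (s * (det2 x v + det2 v y - det2 x y))"
    by (simp add: det2_def algebra_simps)
  also have "0 \<le> \<dots>"
    using assms(2) mult_nonneg_nonneg[OF _ assms(3), of "det2 v y"]
      mult_nonneg_nonneg[OF _ assms(4), of "det2 x v"] mult_nonneg_nonneg[OF _ assms(6), of k] assms(5)
    unfolding wedge_def by linarith
  finally show ?thesis using assms(1) by (simp add: zero_le_mult_iff)
qed

text \<open>For the vertices of the chain itself this is \<open>turning_edges\<close>. The vertices of the other chain lie on
  the far side of the segment \<open>x y\<close>, so the bound passes to them from \<open>x\<close> and \<open>y\<close>.\<close>

lemma opposite_chain_bound: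
  assumes L: "chain (x # M @ [y])" "bent s (x # M @ [y])"
    and U: "chain (x # N @ [y])" "bent (- s) (x # N @ [y])"
    and e: "(a, b) \<in> edges (x # M @ [y])" and v: "v \<in> set (x # M @ N @ [y])"
  shows "0 \<le> s * (det2 a b - det2 a v - det2 v b)"
proof (cases "v \<in> set (x # M @ [y])")
  case True
  then show ?thesis using turning_edges[OF bent_turning[OF L] e] by blast
next
  case False
  then have vN: "v \<in> set N" using v by auto
  have "0 < - s * turn x v y"
    using bent_turning[OF U] vN by (auto simp: sorted_wrt_append)
  then have "0 \<le> - s * (det2 x v + det2 v y - det2 x y)" by (simp add: turn_def)
  moreover have "wedge x y v" "0 < det2 x y"
    using U(1) vN by (auto simp: wedge_def less_imp_le)
  moreover have "0 \<le> - s * (det2 a x + det2 x b - det2 a b)" "0 \<le> - s * (det2 a y + det2 y b - det2 a b)"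
    using turning_edges[OF bent_turning[OF L] e, of x] turning_edges[OF bent_turning[OF L] e, of y]
    by (simp_all add: algebra_simps)
  ultimately have "0 \<le> - s * (det2 a v + det2 v b - det2 a b)"
    using edges_det2[OF L(1) e] combination_bound[of x y v "-s" a b "det2 a b"] by blast
  then show ?thesis by (simp add: algebra_simps)
qed

lemma convex_det2_le: "convex {z. s * (det2 a z + det2 z b) \<le> k}"
proof -
  have "linear (\<lambda>z. s * (det2 a z + det2 z b))"
    by (rule linearI) (simp_all add: det2_lin algebra_simps)
  then have "convex ((\<lambda>z. s * (det2 a z + det2 z b)) -` {..k})"
    by (intro convex_linear_vimage) (auto intro: convex_real_interval)
  then show ?thesis by (simp add: vimage_def)
qed

lemma convex_wedge: "convex {z. wedge x y z}"
proof -
  have "{z. wedge x y z} = {z. 1 * (det2 0 z + det2 z (- y)) \<le> 0} \<inter> {z. 1 * (det2 (- x) z + det2 z 0) \<le> 0}"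
    by (auto simp: wedge_def det2_def)
  then show ?thesis by (simp only: convex_Int convex_det2_le)
qed

lemma interior_direction:
  fixes v :: "'a::real_normed_vector"
  assumes "z \<in> interior Q"
  obtains e where "0 < e" "z + e *\<^sub>R v \<in> Q"
proof -
  obtain d where d: "0 < d" "ball z d \<subseteq> Q" using assms by (auto simp: mem_interior)
  define e where "e = d / (2 * (norm v + 1))"
  have n: "0 < norm v + 1" by (simp add: add_nonneg_pos)
  have "0 < e" using d n by (simp add: e_def)
  moreover have "e * norm v < d"
  proof -
    have "e * norm v \<le> e * (norm v + 1)" using \<open>0 < e\<close> by simp
    also have "\<dots> = d / 2" using n by (simp add: e_def field_simps)
    also have "\<dots> < d" using d by simp
    finally show ?thesis .
  qed
  then have "z + e *\<^sub>R v \<in> ball z d" using \<open>0 < e\<close> by (simp add: dist_norm)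
  ultimately show thesis using d that by blast
qed

lemma interior_wedge:
  assumes "z \<in> interior Q" "\<And>w. w \<in> Q \<Longrightarrow> wedge x y w" "0 < det2 x y"
  shows "0 < det2 x z" "0 < det2 z y"
proof -
  obtain e where e: "0 < e" "z + e *\<^sub>R (-y) \<in> Q" by (rule interior_direction[OF assms(1)])
  then have "0 \<le> det2 x z - e * det2 x y"
    using assms(2)[OF e(2)] by (simp add: wedge_def det2_lin) (simp add: det2_def algebra_simps)
  then show "0 < det2 x z" using e(1) assms(3) mult_pos_pos[OF e(1) assms(3)] by linarith
  obtain e where e: "0 < e" "z + e *\<^sub>R (-x) \<in> Q" by (rule interior_direction[OF assms(1)])
  then have "0 \<le> det2 z y - e * det2 x y"
    using assms(2)[OF e(2)] by (simp add: wedge_def det2_lin) (simp add: det2_def algebra_simps)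
  then show "0 < det2 z y" using e(1) assms(3) mult_pos_pos[OF e(1) assms(3)] by linarith
qed

text \<open>Scaling an interior point slightly stays inside \<open>Q\<close>, which turns a weak bound on \<open>Q\<close> into a strict one,
  since the bounding line misses the origin.\<close>

lemma interior_strict:
  assumes "z \<in> interior Q" "\<And>w. w \<in> Q \<Longrightarrow> s * (det2 a w + det2 w b) \<le> s * k" "0 < k" "s = 1 \<or> s = -1"
  shows "s * (det2 a z + det2 z b) < s * k"
proof -
  obtain e where e: "0 < e" "z + e *\<^sub>R (s *\<^sub>R z) \<in> Q" by (rule interior_direction[OF assms(1)])
  then have *: "s * ((1 + e * s) * (det2 a z + det2 z b)) \<le> s * k"
    using assms(2)[OF e(2)] by (simp add: det2_lin algebra_simps)
  show ?thesis
  proof (rule ccontr)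
    assume "\<not> ?thesis"
    then have h: "s * k \<le> s * (det2 a z + det2 z b)" by simp
    from assms(4) show False
    proof
      assume s: "s = 1"
      then have "(1 + e) * k \<le> (1 + e) * (det2 a z + det2 z b)" using h e by (simp add: mult_left_mono)
      then have "(1 + e) * k \<le> k" using * s by simp
      then show False using mult_pos_pos[OF e(1) assms(3)] by (simp add: algebra_simps)
    next
      assume s: "s = -1"
      then have c: "det2 a z + det2 z b \<le> k" using h by simp
      have "k \<le> (1 - e) * (det2 a z + det2 z b)" using * s by simp
      moreover have pos: "det2 a z + det2 z b > 0"
      proof -
        have "s * (det2 a z + det2 z b) \<le> s * k"
          using assms(1) assms(2) interior_subset by blast
        then show ?thesis using s assms(3) by simp
      qed
      have "(1 - e) * (det2 a z + det2 z b) < det2 a z + det2 z b"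
        using mult_pos_pos[OF e(1) pos] by (simp add: algebra_simps)
      ultimately show False using c by simp
    qed
  qed
qed

lemma under_iff:
  assumes "chain (x # W @ [y])" "wedge x y z"
    "\<And>a b. (a, b) \<in> edges (x # W @ [y]) \<Longrightarrow> det2 a z + det2 z b \<le> det2 a b"
  shows "z \<in> under (x # W @ [y])"
proof -
  obtain a b where "(a, b) \<in> edges (x # W @ [y])" "wedge a b z"
    using wedge_cover[OF assms(1,2)] by blast
  then show ?thesis using assms(3) unfolding under_def by blast
qed

text \<open>The ray through a point of the cone meets the edge \<open>a b\<close>.\<close>

lemma under_scale:
  assumes "0 < det2 a b" "wedge a b z" "k = det2 a z + det2 z b" "0 < k" "convex S" "a \<in> S" "b \<in> S"
  shows "(det2 a b / k) *\<^sub>R z \<in> S"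
proof -
  have "det2 z b / k + det2 a z / k = 1"
    using assms(3,4) by (simp add: add_divide_distrib[symmetric] add.commute)
  then have "(det2 z b / k) *\<^sub>R a + (det2 a z / k) *\<^sub>R b \<in> S"
    using assms by (intro convexD[OF assms(5)]) (simp_all add: wedge_def)
  also have "(det2 z b / k) *\<^sub>R a + (det2 a z / k) *\<^sub>R b = (1 / k) *\<^sub>R (det2 a b *\<^sub>R z)"
    by (simp add: three_term[of a b z] scaleR_add_right)
  finally show ?thesis by simp
qed

section \<open>The lens between a cup and a cap\<close>

lemma convex_ray:
  fixes z :: "'a::real_vector"
  assumes "convex Q" "p *\<^sub>R z \<in> Q" "q *\<^sub>R z \<in> Q" "p < 1" "1 \<le> q"
  shows "z \<in> Q"
proof -
  define u where "u = (1 - p) / (q - p)"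
  have "u * (q - p) = 1 - p"
    using assms(4,5) by (simp add: u_def)
  then have "(1 - u) * p + u * q = 1"
    by (simp add: left_diff_distrib right_diff_distrib)
  moreover have "0 \<le> u" "u \<le> 1"
    using assms(4,5) by (simp_all add: u_def)
  ultimately have u: "0 \<le> u" "u \<le> 1" "(1 - u) * p + u * q = 1" by blast+
  have "(1 - u) *\<^sub>R (p *\<^sub>R z) + u *\<^sub>R (q *\<^sub>R z) \<in> Q"
    using assms u by (intro convexD_alt) auto
  also have "(1 - u) *\<^sub>R (p *\<^sub>R z) + u *\<^sub>R (q *\<^sub>R z) = ((1 - u) * p + u * q) *\<^sub>R z"
    by (simp only: scaleR_add_left scaleR_scaleR)
  finally show ?thesis using u(3) by simp
qed

text \<open>A lens: the chain through \<open>lo\<close> is a cup, the chain through \<open>up\<close> a cap, and \<open>Q\<close> is the convex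
  polygon between them.\<close>

context
  fixes x y lo up Q
  assumes L: "chain (x # lo @ [y])" "bent (-1) (x # lo @ [y])"
    and U: "chain (x # up @ [y])" "bent 1 (x # up @ [y])"
  defines "Q \<equiv> convex hull (set (x # lo @ up @ [y]))"
begin

lemma lens_above: "(a, b) \<in> edges (x # lo @ [y]) \<Longrightarrow> z \<in> Q \<Longrightarrow> det2 a b \<le> det2 a z + det2 z b"
proof -
  assume e: "(a, b) \<in> edges (x # lo @ [y])" and z: "z \<in> Q"
  have "Q \<subseteq> {z. (-1) * (det2 a z + det2 z b) \<le> - det2 a b}"
    unfolding Q_def
  proof (intro hull_minimal convex_det2_le subsetI CollectI)
    fix v assume "v \<in> set (x # lo @ up @ [y])"
    then show "(-1) * (det2 a v + det2 v b) \<le> - det2 a b"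
      using opposite_chain_bound[OF L U(1) _ e, of v] U(2) by simp
  qed
  then show ?thesis using z by auto
qed

lemma lens_below: "(a, b) \<in> edges (x # up @ [y]) \<Longrightarrow> z \<in> Q \<Longrightarrow> det2 a z + det2 z b \<le> det2 a b"
proof -
  assume e: "(a, b) \<in> edges (x # up @ [y])" and z: "z \<in> Q"
  have "Q \<subseteq> {z. 1 * (det2 a z + det2 z b) \<le> det2 a b}"
    unfolding Q_def
  proof (intro hull_minimal convex_det2_le subsetI CollectI)
    fix v assume "v \<in> set (x # lo @ up @ [y])"
    then show "1 * (det2 a v + det2 v b) \<le> det2 a b"
      using opposite_chain_bound[OF U L(1) _ e, of v] L(2) by auto
  qed
  then show ?thesis using z by auto
qed

lemma lens_wedge: "z \<in> Q \<Longrightarrow> wedge x y z"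
proof -
  have "Q \<subseteq> {z. wedge x y z}"
    unfolding Q_def using L(1) U(1)
    by (intro hull_minimal convex_wedge) (auto simp: wedge_def less_imp_le)
  then show "z \<in> Q \<Longrightarrow> wedge x y z" by auto
qed

lemma lens_interior_disjoint: "interior Q \<inter> under (x # lo @ [y]) = {}"
proof -
  have False if z: "z \<in> interior Q" "z \<in> under (x # lo @ [y])" for z
  proof -
    obtain a b where e: "(a, b) \<in> edges (x # lo @ [y])" "det2 a z + det2 z b \<le> det2 a b"
      using z(2) by (auto simp: under_def)
    have "(-1) * (det2 a z + det2 z b) < (-1) * det2 a b"
      using lens_above[OF e(1)] edges_det2[OF L(1) e(1)]
      by (intro interior_strict[OF z(1)]) (auto simp: algebra_simps)
    then show False using e(2) by simp
  qed
  then show ?thesis by blast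
qed

lemma lens_upper_vertex: "v \<in> set (x # up @ [y]) \<Longrightarrow> v \<notin> interior Q"
proof
  assume v: "v \<in> set (x # up @ [y])" "v \<in> interior Q"
  have "wedge x y v" using v(2) interior_subset lens_wedge by blast
  obtain a b where e: "(a, b) \<in> edges (x # up @ [y])" "v = a \<or> v = b"
  proof -
    have "\<exists>(a, b)\<in>edges (c # up @ [y]). v = a \<or> v = b" if "v \<in> set (c # up @ [y])" for c
      using that by (induction up arbitrary: c) auto
    then show thesis using v(1) that by blast
  qed
  have "1 * (det2 a v + det2 v b) < 1 * det2 a b"
    using v(2) lens_below[OF e(1)] edges_det2[OF U(1) e(1)]
    by (intro interior_strict) auto
  then show False using e(2) by auto
qed

text \<open>The ray through a point that is above the lower chain and below the upper one meets both chains, and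
  the point lies between the two intersections. Hence it belongs to the hull of the vertices. For
  the converse, the lines through the edges of both chains bound the lens.\<close>

lemma under_lens: "under (x # up @ [y]) = under (x # lo @ [y]) \<union> Q"
proof (intro equalityI subsetI)
  fix z assume "z \<in> under (x # up @ [y])"
  then obtain c d where cd: "(c, d) \<in> edges (x # up @ [y])" "wedge c d z" "det2 c z + det2 z d \<le> det2 c d"
    by (auto simp: under_def)
  have "wedge x y z" by (rule edge_wedge[OF U(1) cd(1,2)])
  then obtain a b where ab: "(a, b) \<in> edges (x # lo @ [y])" "wedge a b z"
    using wedge_cover[OF L(1)] by blast
  show "z \<in> under (x # lo @ [y]) \<union> Q"
  proof (cases "det2 a z + det2 z b \<le> det2 a b")
    case True
    then show ?thesis using ab by (auto simp: under_def)
  next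
    case False
    \<comment> \<open>The ray through \<open>z\<close> is scaled onto the lower edge \<open>a b\<close> and onto the upper edge \<open>c d\<close>.\<close>
    define k l where "k = det2 a z + det2 z b" and "l = det2 c z + det2 z d"
    have pos: "0 < det2 a b" "0 < det2 c d" using edges_det2[OF L(1) ab(1)] edges_det2[OF U(1) cd(1)] .
    have k: "det2 a b < k" "0 < k" using False pos by (simp_all add: k_def)
    have "l \<noteq> 0"
    proof
      assume "l = 0"
      then have "det2 c z = 0" "det2 z d = 0" using cd(2) by (auto simp: l_def wedge_def)
      then have "det2 c d *\<^sub>R z = 0" by (simp add: three_term[of c d z])
      then have "z = 0" using pos by simp
      then show False using k pos by (simp add: k_def)
    qed
    then have l: "0 < l" "l \<le> det2 c d" using cd by (auto simp: l_def wedge_def)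
    have Q: "convex Q" "set (x # lo @ up @ [y]) \<subseteq> Q"
      unfolding Q_def by (auto simp: hull_inc)
    have "a \<in> Q" "b \<in> Q" "c \<in> Q" "d \<in> Q"
      using edges_subset[OF ab(1)] edges_subset[OF cd(1)] Q(2) by auto
    then have "(det2 a b / k) *\<^sub>R z \<in> Q" "(det2 c d / l) *\<^sub>R z \<in> Q"
      using under_scale[OF pos(1) ab(2) k_def k(2) Q(1)] under_scale[OF pos(2) cd(2) l_def l(1) Q(1)]
      by auto
    moreover have "det2 a b / k < 1" "1 \<le> det2 c d / l" using k l by simp_all
    ultimately show ?thesis using convex_ray[OF Q(1)] by blast
  qed
next
  fix z assume "z \<in> under (x # lo @ [y]) \<union> Q"
  then show "z \<in> under (x # up @ [y])"
  proof
    assume "z \<in> Q"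
    then show ?thesis
      using lens_wedge lens_below by (intro under_iff[OF U(1)]) auto
  next
    assume "z \<in> under (x # lo @ [y])"
    then obtain a b where ab: "(a, b) \<in> edges (x # lo @ [y])" "wedge a b z" "det2 a z + det2 z b \<le> det2 a b"
      by (auto simp: under_def)
    have pos: "0 < det2 a b" by (rule edges_det2[OF L(1) ab(1)])
    have Q: "a \<in> Q" "b \<in> Q"
      using edges_subset[OF ab(1)] unfolding Q_def by (auto simp: hull_inc)
    show ?thesis
    proof (rule under_iff[OF U(1) edge_wedge[OF L(1) ab(1,2)]])
      fix c d assume cd: "(c, d) \<in> edges (x # up @ [y])"
      have "0 < det2 c d" by (rule edges_det2[OF U(1) cd])
      have "0 \<le> - 1 * (det2 c z + det2 z d - det2 c d)"
        by (rule combination_bound[OF pos ab(2)])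
          (use lens_below[OF cd Q(1)] lens_below[OF cd Q(2)] ab(3) \<open>0 < det2 c d\<close> in simp_all)
      then show "det2 c z + det2 z d \<le> det2 c d" by simp
    qed
  qed
qed

end

section \<open>Partitions of the region under a chain\<close>

text \<open>The set \<open>V\<close> holds the given points other than the origin. Every piece is the hull
  of given points, which makes it convex with vertices among them.\<close>

definition partition_under :: "pt set \<Rightarrow> nat \<Rightarrow> pt list \<Rightarrow> bool" where
  "partition_under V N L \<longleftrightarrow> (\<exists>D. finite D \<and> card D \<le> N \<and>
     (\<forall>Q\<in>D. interior Q \<noteq> {} \<and> (\<exists>T \<subseteq> insert 0 V. Q = convex hull T) \<and> insert 0 V \<inter> interior Q = {}) \<and>
     pairwise (\<lambda>Q R. interior Q \<inter> interior R = {}) D \<and> \<Union>D = under L)"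

lemma interior_hull_nonempty:
  assumes "turn a b c \<noteq> 0" "a \<in> T" "b \<in> T" "c \<in> T"
  shows "interior (convex hull T) \<noteq> {}"
proof -
  have "\<not> collinear {a, b, c}" using assms(1) turn_zero_iff by blast
  then have "interior (convex hull {a, b, c}) =
         {v. \<exists>x y z. 0 < x \<and> 0 < y \<and> 0 < z \<and> x + y + z = 1 \<and> x *\<^sub>R a + y *\<^sub>R b + z *\<^sub>R c = v}"
    by (intro interior_convex_hull_3_minimal) auto
  moreover have "0 < (1/3::real)" "(1/3::real) + 1/3 + 1/3 = 1" by auto
  ultimately have "(1/3::real) *\<^sub>R a + (1/3::real) *\<^sub>R b + (1/3::real) *\<^sub>R c \<in> interior (convex hull {a, b, c})"
    by blast
  moreover have "interior (convex hull {a, b, c}) \<subseteq> interior (convex hull T)"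
    using assms by (intro interior_mono hull_mono) auto
  ultimately show ?thesis by blast
qed

text \<open>The parts of a chain before \<open>x\<close> and after \<open>y\<close> stay outside the open cone between \<open>x\<close> and \<open>y\<close>, so
  a change between \<open>x\<close> and \<open>y\<close> can be treated locally.\<close>

lemma under_outside:
  assumes "chain (al @ x # W @ y # be)"
    "z \<in> under (al @ [x]) \<or> z \<in> under (y # be)"
  shows "\<not> (0 < det2 x z \<and> 0 < det2 z y)"
proof -
  have "det2 x z \<le> 0" if "z \<in> under (al @ [x])"
  proof -
    obtain a b where e: "(a, b) \<in> edges (al @ [x])" "wedge a b z"
      using \<open>z \<in> under (al @ [x])\<close> by (auto simp: under_def)
    have "chain (al @ [x])" using assms(1) by auto
    then have "0 < det2 a b" "0 \<le> det2 a x" "0 \<le> det2 b x"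
      using edges_det2[of "al @ [x]" a b] edges_subset[OF e(1)] e(1) assms(1) by (auto simp: less_imp_le)
    then have "wedge a x z"
      using e(2) by (intro wedge_mono[OF e(2)]) auto
    then show ?thesis by (simp add: wedge_def det2_swap[of z x])
  qed
  moreover have "det2 z y \<le> 0" if "z \<in> under (y # be)"
  proof -
    obtain a b where e: "(a, b) \<in> edges (y # be)" "wedge a b z"
      using \<open>z \<in> under (y # be)\<close> by (auto simp: under_def)
    have "chain (y # be)" using assms(1) by auto
    then have "0 < det2 a b" "0 \<le> det2 y a" "0 \<le> det2 y b"
      using edges_det2[of "y # be" a b] edges_subset[OF e(1)] e(1) assms(1) by (auto simp: less_imp_le)
    then have "wedge y b z"
      using e(2) by (intro wedge_mono[OF e(2)]) auto
    then show ?thesis by (simp add: wedge_def det2_swap[of z y])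
  qed
  ultimately show ?thesis using assms(2) by auto
qed

lemma under_split:
  "under (al @ x # W @ y # be) = under (al @ [x]) \<union> under (x # W @ [y]) \<union> under (y # be)"
  using under_append[of al x "W @ y # be"] under_append[of "x # W" y be] by auto

lemma under_vertex:
  assumes "chain (x # W @ [y])" "v \<in> set (x # W @ [y])"
  shows "v \<in> under (x # W @ [y])"
proof -
  have "\<exists>(a, b)\<in>edges (x # W @ [y]). v = a \<or> v = b"
    using assms(2) by (induction W arbitrary: x) auto
  then obtain a b where e: "(a, b) \<in> edges (x # W @ [y])" "v = a \<or> v = b" by blast
  have "0 < det2 a b" by (rule edges_det2[OF assms(1) e(1)])
  then have "wedge a b v \<and> det2 a v + det2 v b \<le> det2 a b" using e(2) by (auto simp: wedge_def)
  then show ?thesis using e(1) unfolding under_def by blast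
qed

lemma partition_add:
  assumes D: "partition_under V N L" and u: "under L' = under L \<union> Q"
    and Q: "interior Q \<noteq> {}" "Q = convex hull T" "T \<subseteq> insert 0 V"
    "insert 0 V \<inter> interior Q = {}" and dis: "interior Q \<inter> under L = {}"
  shows "partition_under V (Suc N) L'"
proof -
  obtain D where D: "finite D" "card D \<le> N"
     "\<forall>Q\<in>D. interior Q \<noteq> {} \<and> (\<exists>T \<subseteq> insert 0 V. Q = convex hull T) \<and> insert 0 V \<inter> interior Q = {}"
     "pairwise (\<lambda>Q R. interior Q \<inter> interior R = {}) D" "\<Union>D = under L"
    using D unfolding partition_under_def by blast
  have "interior Q \<inter> interior R = {}" if "R \<in> D" for R
    using that D(5) dis interior_subset[of R] by blast
  then have "pairwise (\<lambda>Q R. interior Q \<inter> interior R = {}) (insert Q D)"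
    using D(4) by (auto simp: pairwise_insert)
  moreover have "card (insert Q D) \<le> Suc N"
    using D(1,2) card_insert_le_m1 by (simp add: card_insert_if)
  ultimately show ?thesis
    unfolding partition_under_def using D Q u by (intro exI[of _ "insert Q D"]) auto
qed

text \<open>Replacing a cup by a cap with the same ends adds exactly the lens between them. A given point
  strictly inside its cone is harmless if it is a vertex of the cap or was already covered.\<close>

lemma partition_step:
  assumes D: "partition_under V N (al @ x # lo @ y # be)"
    and L: "chain (al @ x # lo @ y # be)" "bent (-1) (x # lo @ [y])"
    and U: "chain (al @ x # up @ y # be)" "bent 1 (x # up @ [y])"
    and V: "set (x # lo @ up @ [y]) \<subseteq> V" and ne: "lo @ up \<noteq> []"
    and pts: "\<And>v. v \<in> V \<Longrightarrow> 0 < det2 x v \<Longrightarrow> 0 < det2 v y \<Longrightarrow> v \<in> set up \<union> under (x # lo @ [y])"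
  shows "partition_under V (Suc N) (al @ x # up @ y # be)"
proof -
  have L1: "chain (x # lo @ [y])" and U1: "chain (x # up @ [y])" using L(1) U(1) by auto
  note lens = L1 L(2) U1 U(2)
  define Q where "Q = convex hull (set (x # lo @ up @ [y]))"
  have xy: "0 < det2 x y" using L1 by auto
  have int: "0 < det2 x z" "0 < det2 z y" if "z \<in> interior Q" for z
    using interior_wedge[OF that, of x y] lens_wedge[OF lens] xy unfolding Q_def by blast+
  have "interior Q \<inter> under (al @ x # lo @ y # be) = {}"
    using int lens_interior_disjoint[OF lens] under_outside[OF L(1)]
    unfolding Q_def under_split by blast
  moreover have "insert 0 V \<inter> interior Q = {}"
  proof -
    have False if v: "v \<in> V" "v \<in> interior Q" for v
    proof -
      have "v \<in> set up \<union> under (x # lo @ [y])" using pts[OF v(1)] int[OF v(2)] by blast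
      then show False
        using lens_upper_vertex[OF lens, of v] lens_interior_disjoint[OF lens] v(2) unfolding Q_def by auto
    qed
    moreover have "0 \<notin> interior Q" using int(1)[of 0] by auto
    ultimately show ?thesis by blast
  qed
  moreover have "under (al @ x # up @ y # be) = under (al @ x # lo @ y # be) \<union> Q"
    using under_lens[OF lens] unfolding under_split Q_def by blast
  moreover have "interior Q \<noteq> {}"
  proof -
    have "turn x w y \<noteq> 0" if "w \<in> set (lo @ up)" for w
      using that bent_turning[OF L1 L(2)] bent_turning[OF U1 U(2)]
      by (auto simp: sorted_wrt_append)
    moreover have "hd (lo @ up) \<in> set (lo @ up)"
      using ne by (rule hd_in_set)
    ultimately have "\<exists>w \<in> set (lo @ up). turn x w y \<noteq> 0" by blast
    then show ?thesis
      unfolding Q_def by (elim bexE) (rule interior_hull_nonempty, auto)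
  qed
  ultimately show ?thesis
    using V by (intro partition_add[OF D _ _ Q_def]) auto
qed

section \<open>Cutting along rays to the valleys\<close>

definition no_three :: "pt set \<Rightarrow> bool" where
  "no_three V \<longleftrightarrow> (\<forall>a\<in>V. \<forall>b\<in>V. \<forall>c\<in>V. a \<noteq> b \<and> a \<noteq> c \<and> b \<noteq> c \<longrightarrow> turn a b c \<noteq> 0)"

fun valley_count :: "pt list \<Rightarrow> nat" where
  "valley_count (a # b # c # L) = (if turn a b c < 0 then 1 else 0) + valley_count (b # c # L)"
| "valley_count _ = 0"

text \<open>The sign of an inner vertex depends only on its two neighbours, so counting splits at an edge.\<close>

lemma valley_count_append: "valley_count (al @ x # w # r) = valley_count (al @ [x, w]) + valley_count (x # w # r)"
proof (induction al)
  case (Cons a al)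
  then show ?case
    by (cases al rule: list.exhaust; cases "tl al") auto
qed simp

lemma valley_count_snoc: "valley_count (al @ [a, b, c]) = valley_count (al @ [a, b]) + (if turn a b c < 0 then 1 else 0)"
  using valley_count_append[of al a b "[c]"] by simp

lemma valley_count_split: "0 < valley_count L \<Longrightarrow> \<exists>al u q w be. L = al @ u # q # w # be \<and> turn u q w < 0"
proof (induction L rule: valley_count.induct)
  case (1 a b c L)
  show ?case
  proof (cases "turn a b c < 0")
    case True
    then show ?thesis by (intro exI[of _ "[]"]) auto
  next
    case False
    then obtain al u q w be where "b # c # L = al @ u # q # w # be" "turn u q w < 0"
      using 1 by auto
    then show ?thesis by (intro exI[of _ "a # al"]) auto
  qed
qed auto

lemma chain_turn_nonzero:
  assumes "no_three V" "chain (a # b # c # L)" "{a, b, c} \<subseteq> V"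
  shows "turn a b c \<noteq> 0"
proof -
  have "a \<noteq> b" "a \<noteq> c" "b \<noteq> c" using assms(2) by auto
  then show ?thesis using assms unfolding no_three_def by blast
qed

lemma valley_count_zero_bent: "valley_count L = 0 \<Longrightarrow> chain L \<Longrightarrow> no_three V \<Longrightarrow> set L \<subseteq> V \<Longrightarrow> bent 1 L"
proof (induction L rule: valley_count.induct)
  case (1 a b c L)
  have "turn a b c \<noteq> 0" using 1(3-5) by (intro chain_turn_nonzero) auto
  then show ?case using 1 by (auto split: if_splits)
qed auto

text \<open>Under a cap the region is convex.\<close>

lemma under_fan:
  assumes "chain (x # W @ [y])" "bent 1 (x # W @ [y])"
  shows "under (x # W @ [y]) = convex hull (insert 0 (set (x # W @ [y])))" (is "_ = ?H")
proof (intro equalityI subsetI)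
  fix z assume "z \<in> under (x # W @ [y])"
  then obtain a b where ab: "(a, b) \<in> edges (x # W @ [y])" "wedge a b z" "det2 a z + det2 z b \<le> det2 a b"
    by (auto simp: under_def)
  have pos: "0 < det2 a b" by (rule edges_det2[OF assms(1) ab(1)])
  have s: "det2 z b / det2 a b + det2 a z / det2 a b \<le> 1" using ab(3) pos by (simp add: field_simps)
  have "z = (1 / det2 a b) *\<^sub>R (det2 a b *\<^sub>R z)" using pos by simp
  also have "\<dots> = (1 - (det2 z b / det2 a b + det2 a z / det2 a b)) *\<^sub>R 0
      + (det2 z b / det2 a b) *\<^sub>R a + (det2 a z / det2 a b) *\<^sub>R b"
    by (simp add: three_term[of a b z] scaleR_add_right)
  also have "\<dots> \<in> convex hull {0, a, b}"
    unfolding convex_hull_3 using s ab(2) pos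
    by (intro CollectI exI conjI) (rule refl, simp_all add: wedge_def)
  also have "convex hull {0, a, b} \<subseteq> ?H"
    using edges_subset[OF ab(1)] by (intro hull_mono) auto
  finally show "z \<in> ?H" .
next
  fix z assume z: "z \<in> ?H"
  show "z \<in> under (x # W @ [y])"
  proof (rule under_iff[OF assms(1)])
    have "?H \<subseteq> {z. wedge x y z}" using assms(1)
      by (intro hull_minimal convex_wedge) (auto simp: wedge_def less_imp_le)
    then show "wedge x y z" using z by blast
    fix a b assume e: "(a, b) \<in> edges (x # W @ [y])"
    have "?H \<subseteq> {z. 1 * (det2 a z + det2 z b) \<le> det2 a b}"
    proof (intro hull_minimal convex_det2_le subsetI CollectI)
      fix v assume "v \<in> insert 0 (set (x # W @ [y]))"
      then show "1 * (det2 a v + det2 v b) \<le> det2 a b"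
        using turning_edges[OF bent_turning[OF assms] e, of v] edges_det2[OF assms(1) e] by auto
    qed
    then show "det2 a z + det2 z b \<le> det2 a b" using z by auto
  qed
qed

lemma partition_fan:
  assumes "chain (x # W @ [y])" "bent 1 (x # W @ [y])" "set (x # W @ [y]) \<subseteq> V"
    and "\<And>a b v. (a, b) \<in> edges (x # W @ [y]) \<Longrightarrow> v \<in> V \<Longrightarrow> wedge a b v \<Longrightarrow> det2 a b \<le> det2 a v + det2 v b"
  shows "partition_under V 1 (x # W @ [y])"
proof -
  define Q where "Q = convex hull (insert 0 (set (x # W @ [y])))"
  have u: "under (x # W @ [y]) = Q" using under_fan[OF assms(1,2)] by (simp add: Q_def)
  have w: "wedge x y z" if "z \<in> Q" for z using under_wedge[OF assms(1)] that u by blast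
  have xy: "0 < det2 x y" using assms(1) by auto
  have "interior Q \<noteq> {}"
    unfolding Q_def using xy by (intro interior_hull_nonempty[of 0 x y]) (auto simp: turn_def)
  moreover have "0 \<notin> interior Q"
    using interior_wedge(1)[of 0 Q x y] w xy by auto
  moreover have "v \<notin> interior Q" if v: "v \<in> V" for v
  proof
    assume i: "v \<in> interior Q"
    then have "wedge x y v" using w interior_subset by blast
    then obtain a b where e: "(a, b) \<in> edges (x # W @ [y])" "wedge a b v"
      using wedge_cover[OF assms(1)] by blast
    have "Q \<subseteq> {z. 1 * (det2 a z + det2 z b) \<le> det2 a b}"
      unfolding Q_def
    proof (intro hull_minimal convex_det2_le subsetI CollectI)
      fix v assume "v \<in> insert 0 (set (x # W @ [y]))"
      then show "1 * (det2 a v + det2 v b) \<le> det2 a b"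
        using turning_edges[OF bent_turning[OF assms(1,2)] e(1), of v] edges_det2[OF assms(1) e(1)] by auto
    qed
    then have "1 * (det2 a v + det2 v b) < 1 * det2 a b"
      using edges_det2[OF assms(1) e(1)] by (intro interior_strict[OF i]) auto
    then show False using assms(4)[OF e(1) v e(2)] by simp
  qed
  ultimately show ?thesis
    unfolding partition_under_def u using assms(3)
    by (intro exI[of _ "{Q}"]) (auto simp: Q_def intro!: exI[of _ "insert 0 (set (x # W @ [y]))"])
qed

lemma partition_join:
  assumes "partition_under V M (x # al @ [q])" "partition_under V N (q # be @ [y])"
    and ch: "chain (x # al @ q # be @ [y])"
  shows "partition_under V (M + N) (x # al @ q # be @ [y])"
proof -
  obtain D where D: "finite D" "card D \<le> M"
     "\<forall>Q\<in>D. interior Q \<noteq> {} \<and> (\<exists>T \<subseteq> insert 0 V. Q = convex hull T) \<and> insert 0 V \<inter> interior Q = {}"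
     "pairwise (\<lambda>Q R. interior Q \<inter> interior R = {}) D" "\<Union>D = under (x # al @ [q])"
    using assms(1) unfolding partition_under_def by blast
  obtain E where E: "finite E" "card E \<le> N"
     "\<forall>Q\<in>E. interior Q \<noteq> {} \<and> (\<exists>T \<subseteq> insert 0 V. Q = convex hull T) \<and> insert 0 V \<inter> interior Q = {}"
     "pairwise (\<lambda>Q R. interior Q \<inter> interior R = {}) E" "\<Union>E = under (q # be @ [y])"
    using assms(2) unfolding partition_under_def by blast
  have c: "chain (x # al @ [q])" "chain (q # be @ [y])" "0 < det2 x q" "0 < det2 q y" using ch by auto
  have dis: "interior Q \<inter> interior R = {}" if Q: "Q \<in> D" and R: "R \<in> E" for Q R
  proof -
    have "wedge x q w" if "w \<in> Q" for w
      using that Q D(5) under_wedge[OF c(1)] by blast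
    moreover have "wedge q y w" if "w \<in> R" for w
      using that R E(5) under_wedge[OF c(2)] by blast
    ultimately have "0 < det2 z q" "0 < det2 q z" if "z \<in> interior Q \<inter> interior R" for z
      using that interior_wedge[of z Q x q] interior_wedge[of z R q y] c by blast+
    then show ?thesis by (force simp: det2_swap[of _ q])
  qed
  have "pairwise (\<lambda>Q R. interior Q \<inter> interior R = {}) (D \<union> E)"
    using D(4) E(4) dis unfolding pairwise_def by blast
  moreover have "card (D \<union> E) \<le> M + N"
    using D(2) E(2) card_Un_le[of D E] by simp
  moreover have "\<Union>(D \<union> E) = under (x # al @ q # be @ [y])"
    using D(5) E(5) under_append[of "x # al" q "be @ [y]"] by simp
  ultimately show ?thesis
    unfolding partition_under_def using D(1,3) E(1,3) by (intro exI[of _ "D \<union> E"]) blast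
qed

text \<open>Cutting at a valley gives two chains with all other signs unchanged, and a chain without valleys is a
  single convex piece. The condition on \<open>V\<close> says that no given point lies strictly under \<open>L\<close>.\<close>

lemma partition_slabs:
  assumes "no_three V" "chain L" "2 \<le> length L" "set L \<subseteq> V"
    and "\<And>a b v. (a, b) \<in> edges L \<Longrightarrow> v \<in> V \<Longrightarrow> wedge a b v \<Longrightarrow> det2 a b \<le> det2 a v + det2 v b"
  shows "partition_under V (Suc (valley_count L)) L"
  using assms(2-)
proof (induction L rule: length_induct)
  case (1 L)
  show ?case
  proof (cases "valley_count L = 0")
    case True
    have b: "bent 1 L" using valley_count_zero_bent[OF True 1(2) assms(1) 1(4)] .
    obtain x W y where L: "L = x # W @ [y]"
      using 1(3) by (metis Suc_le_length_iff append_butlast_last_id list.size(3) not_one_le_zero numeral_2_eq_2 One_nat_def)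
    show ?thesis using partition_fan[of x W y V] 1 b True unfolding L by simp
  next
    case False
    then obtain al u q w be where L: "L = al @ u # q # w # be" "turn u q w < 0"
      using valley_count_split by blast
    have e: "edges (al @ [u, q]) \<subseteq> edges L" "edges (q # w # be) \<subseteq> edges L"
      using edges_append[of "al @ [u]" q "w # be"] by (auto simp: L)
    have IH: "partition_under V (Suc (valley_count M)) M"
      if "length M < length L" "chain M" "2 \<le> length M" "set M \<subseteq> V" "edges M \<subseteq> edges L" for M
      using 1(1) 1(5) that by (meson subsetD)
    have 2: "partition_under V (Suc (valley_count (al @ [u, q]))) (al @ [u, q])"
      using 1(2-4) e by (intro IH) (auto simp: L)
    have 3: "partition_under V (Suc (valley_count (q # w # be))) (q # w # be)"
      using 1(2-4) e by (intro IH) (auto simp: L)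
    obtain x al' where x: "al @ [u] = x # al'" by (cases "al @ [u]") auto
    obtain be' y where y: "w # be = be' @ [y]" by (metis append_butlast_last_id list.distinct(1))
    have ns: "valley_count L = valley_count (al @ [u, q]) + 1 + valley_count (q # w # be)"
      using valley_count_append[of al u q "w # be"] L by simp
    have "L = (al @ [u]) @ q # (w # be)" using L(1) by simp
    then have L': "L = x # al' @ q # be' @ [y]" by (simp only: x y append_Cons append_assoc)
    have xe: "al @ [u, q] = x # al' @ [q]"
      using arg_cong[OF x, of "\<lambda>l. l @ [q]"] by simp
    have ye: "q # w # be = q # be' @ [y]" using y by simp
    have "partition_under V (Suc (valley_count (al @ [u, q])) + Suc (valley_count (q # w # be))) (x # al' @ q # be' @ [y])"
      using 2[unfolded xe] 3[unfolded ye] 1(2)[unfolded L'] unfolding xe ye by (rule partition_join)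
    then have "partition_under V (Suc (valley_count (al @ [u, q])) + Suc (valley_count (q # w # be))) L"
      unfolding L' .
    then show ?thesis using ns by simp
  qed
qed

section \<open>Removing valleys from above\<close>

lemma dominated_between:
  assumes "chain (al @ x # W @ y # be)" "v \<in> under (al @ x # W @ y # be)" "0 < det2 x v" "0 < det2 v y"
  shows "v \<in> under (x # W @ [y])"
  using assms under_outside[OF assms(1)] unfolding under_split by blast

lemma under_cut_valley:
  assumes "chain (al @ x # lo @ y # be)" "bent (-1) (x # lo @ [y])"
  shows "under (al @ x # lo @ y # be) \<subseteq> under (al @ x # y # be)"
proof -
  have "under (x # lo @ [y]) \<subseteq> under (x # [] @ [y])"
    using under_lens[of x lo y "[]"] assms by auto
  then show ?thesis
    using under_split[of al x lo y be] under_split[of al x "[]" y be] by auto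
qed

lemma partition_cut_valley:
  assumes "partition_under V N (al @ x # lo @ y # be)"
    and "chain (al @ x # lo @ y # be)" "bent (-1) (x # lo @ [y])"
    and "set (x # lo @ [y]) \<subseteq> V" "lo \<noteq> []"
    and "\<And>v. v \<in> V \<Longrightarrow> 0 < det2 x v \<Longrightarrow> 0 < det2 v y \<Longrightarrow> v \<in> under (x # lo @ [y])"
  shows "partition_under V (Suc N) (al @ x # y # be)"
  using partition_step[OF assms(1-3), of "[]"] assms(2,4-) by auto

lemma cut_valleys:
  assumes ch: "chain (al @ x # lo @ y # be)" and V: "set (al @ x # lo @ y # be) \<subseteq> V"
    and dom: "V \<subseteq> under (al @ x # lo @ y # be)" and b: "bent (-1) (x # lo @ [y])"
    and lo: "lo \<noteq> []" and p: "partition_under V N (al @ x # lo @ y # be)"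
  shows "partition_under V (Suc N) (al @ x # y # be)" "V \<subseteq> under (al @ x # y # be)"
proof -
  have "v \<in> under (x # lo @ [y])" if "v \<in> V" "0 < det2 x v" "0 < det2 v y" for v
    using dominated_between[OF ch] dom that by blast
  then show "partition_under V (Suc N) (al @ x # y # be)"
    using partition_cut_valley[OF p ch b _ lo] V by auto
  show "V \<subseteq> under (al @ x # y # be)"
    using dom under_cut_valley[OF ch b] by blast
qed

text \<open>The first maximal run of valleys of \<open>x # L\<close>, possibly empty, together with the end \<open>y\<close> of the
  run, which is a peak or the last vertex.\<close>

lemma maximal_valley:
  assumes "L \<noteq> []"
  shows "\<exists>run y rest. L = run @ y # rest \<and> bent (-1) (x # run @ [y]) \<and>
    (rest = [] \<or> \<not> turn (last (x # run)) y (hd rest) < 0)"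
  using assms
proof (induction L arbitrary: x)
  case (Cons y M)
  show ?case
  proof (cases "M \<noteq> [] \<and> turn x y (hd M) < 0")
    case True
    then obtain run z rest where r: "M = run @ z # rest" "bent (-1) (y # run @ [z])"
      "rest = [] \<or> \<not> turn (last (y # run)) z (hd rest) < 0"
      using Cons.IH[of y] by blast
    have "bent (-1) (x # (y # run) @ [z])"
      using r True by (cases run) auto
    then show ?thesis using r by (intro exI[of _ "y # run"] exI[of _ z] exI[of _ rest]) auto
  next
    case False
    then show ?thesis by (intro exI[of _ "[]"] exI[of _ y] exI[of _ M]) auto
  qed
qed simp

fun valley_pairs :: "pt list \<Rightarrow> nat" where
  "valley_pairs (a # b # c # d # L) =
     (if turn a b c < 0 \<and> turn b c d < 0 then 1 else 0) + valley_pairs (b # c # d # L)"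
| "valley_pairs _ = 0"

text \<open>A run of \<open>k\<close> valleys contributes \<open>k - 1\<close> pairs; truncated subtraction is right for the empty run.\<close>

lemma valley_pairs_run:
  assumes "bent (-1) (x # run @ [y])" "rest = [] \<or> \<not> turn (last (x # run)) y (hd rest) < 0"
  shows "valley_pairs (x # run @ y # rest) = (length run - 1) + valley_pairs (y # rest)"
  using assms
proof (induction run arbitrary: x)
  case Nil
  then show ?case by (cases rest rule: list.exhaust; cases "tl rest") auto
next
  case (Cons r run)
  show ?case
  proof (cases run)
    case Nil
    have "valley_pairs (r # y # rest) = valley_pairs (y # rest)"
      using Cons.prems(2) Nil by (cases rest rule: list.exhaust; cases "tl rest") auto
    moreover have "valley_pairs (x # r # y # rest) = valley_pairs (r # y # rest)"
      using Cons.prems(2) Nil by (cases rest) auto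
    ultimately show ?thesis using Nil by simp
  next
    case (Cons s run')
    have "valley_pairs (r # run @ y # rest) = (length run - 1) + valley_pairs (y # rest)"
      using Cons.IH[of r] Cons.prems Cons by auto
    moreover have "valley_pairs (x # r # run @ y # rest) = 1 + valley_pairs (r # run @ y # rest)"
      using Cons.prems(1) Cons by (cases run') auto
    ultimately show ?thesis using Cons by simp
  qed
qed

text \<open>Each maximal run of valleys is removed by one polygon. All runs are determined by the original chain; the
  already treated part \<open>al\<close> is only carried along, since its changes do not alter the shape of later runs.\<close>

lemma merge_valleys:
  assumes "chain (al @ x # L)" "set (al @ x # L) \<subseteq> V" "V \<subseteq> under (al @ x # L)"
    "partition_under V N (al @ x # L)"
  shows "\<exists>L' M. chain (al @ x # L') \<and> set L' \<subseteq> set L \<and> (L \<noteq> [] \<longrightarrow> L' \<noteq> []) \<and>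
     V \<subseteq> under (al @ x # L') \<and> partition_under V M (al @ x # L') \<and> M + length L' + valley_pairs (x # L) = N + length L"
  using assms
proof (induction L arbitrary: al x N rule: length_induct)
  case (1 L)
  show ?case
  proof (cases "L = []")
    case True
    then show ?thesis using 1 by (intro exI[of _ "[]"] exI[of _ N]) auto
  next
    case False
    then obtain run y rest where r: "L = run @ y # rest" "bent (-1) (x # run @ [y])"
       "rest = [] \<or> \<not> turn (last (x # run)) y (hd rest) < 0"
      using maximal_valley by blast
    define N' where "N' = (if run = [] then N else Suc N)"
    have c: "partition_under V N' (al @ x # y # rest)" "V \<subseteq> under (al @ x # y # rest)"
    proof -
      show "partition_under V N' (al @ x # y # rest)"
        using cut_valleys(1)[of al x run y rest V N] 1 r by (cases "run = []") (auto simp: N'_def)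
      show "V \<subseteq> under (al @ x # y # rest)"
        using cut_valleys(2)[of al x run y rest V N] 1 r by (cases "run = []") auto
    qed
    have "length rest < length L" using r by simp
    moreover have "chain ((al @ [x]) @ y # rest)" "set ((al @ [x]) @ y # rest) \<subseteq> V"
      "V \<subseteq> under ((al @ [x]) @ y # rest)" "partition_under V N' ((al @ [x]) @ y # rest)"
      using 1(2,3) c r by auto
    ultimately obtain L' M where L': "chain ((al @ [x]) @ y # L')" "set L' \<subseteq> set rest"
      "V \<subseteq> under ((al @ [x]) @ y # L')" "partition_under V M ((al @ [x]) @ y # L')"
      "M + length L' + valley_pairs (y # rest) = N' + length rest"
      using 1(1) by blast
    have "M + length (y # L') + valley_pairs (x # L) = N + length L"
      using L'(5) valley_pairs_run[OF r(2,3)] r(1) by (cases run) (auto simp: N'_def)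
    then show ?thesis using L' r(1) by (intro exI[of _ "y # L'"] exI[of _ M]) auto
  qed
qed

text \<open>Removing a single valley adds a triangle and shortens the chain by one, so the sum of the number of
  pieces and the length does not change.\<close>

lemma triangulate_valleys:
  assumes "no_three V" "chain L" "set L \<subseteq> V" "V \<subseteq> under L" "partition_under V N L" "2 \<le> length L"
  shows "\<exists>L' M. chain L' \<and> bent 1 L' \<and> set L' \<subseteq> set L \<and> V \<subseteq> under L' \<and> 2 \<le> length L' \<and>
     partition_under V M L' \<and> M + length L' = N + length L"
  using assms(2-)
proof (induction L arbitrary: N rule: length_induct)
  case (1 L)
  show ?case
  proof (cases "valley_count L = 0")
    case True
    then show ?thesis using valley_count_zero_bent[OF True 1(2) assms(1) 1(3)] 1(2-) by blast
  next
    case False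
    then obtain al u q w be where L: "L = al @ u # [q] @ w # be" "turn u q w < 0"
      using valley_count_split[of L] by auto
    define L2 where "L2 = al @ u # w # be"
    have b: "bent (-1) (u # [q] @ [w])" using L(2) by simp
    have c: "partition_under V (Suc N) L2" "V \<subseteq> under L2"
      using cut_valleys[of al u "[q]" w be V N] 1(2-) b unfolding L(1) L2_def by blast+
    have l: "length L = Suc (length L2)" "chain L2" "set L2 \<subseteq> set L" "2 \<le> length L2"
      using 1(2) unfolding L(1) L2_def by auto
    then obtain L' M where "chain L' \<and> bent 1 L' \<and> set L' \<subseteq> set L2 \<and> V \<subseteq> under L' \<and> 2 \<le> length L' \<and>
     partition_under V M L' \<and> M + length L' = Suc N + length L2"
      using 1(1)[rule_format, of L2 "Suc N"] c subset_trans[OF l(3) 1(3)] by auto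
    then show ?thesis using l by (intro exI[of _ L'] exI[of _ M]) auto
  qed
qed

section \<open>Bypassing a run of peaks\<close>

lemma bent_join: "bent s (L @ [p, q]) \<Longrightarrow> bent s (p # q # M) \<Longrightarrow> bent s (L @ p # q # M)"
proof (induction L)
  case (Cons a L)
  then show ?case by (cases L rule: list.exhaust; cases "tl L") auto
qed simp

lemma bent_snoc: "bent s (L @ [p, q, r]) \<longleftrightarrow> bent s (L @ [p, q]) \<and> 0 < s * turn p q r"
proof (induction L)
  case (Cons a L)
  then show ?case by (cases L rule: list.exhaust; cases "tl L") auto
qed simp

text \<open>Moving the first end point of a cap to a valley \<open>a\<close> between it and the next vertex keeps a cap:
  seen from the lower point \<open>a\<close>, that vertex is still a peak.\<close>

lemma bent_replace_first:
  assumes "chain (x # a # C @ [y])" "bent 1 (x # C @ [y])" "C \<noteq> []" "turn x a (hd C) < 0"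
  shows "bent 1 (a # C @ [y])"
proof -
  obtain p z M where C: "C @ [y] = p # z # M" "hd C = p"
    using assms(3) by (cases C rule: list.exhaust; cases "tl C") auto
  have pos: "0 < det2 a p" "0 < det2 p z" "0 < det2 x p"
    using assms(1) C(1) by (metis Cons_eq_appendI append_Cons chain_simps(2) list.set_intros(1,2))+
  have "0 < turn x p z" using assms(2) C by simp
  then have "0 < det2 x p * turn a p z"
    using turn_exchange_right[of x p z a] pos assms(4) C(2) mult_pos_pos[of "turn x p z" "det2 a p"]
      mult_pos_neg[of "det2 p z" "turn x a p"] by simp
  then have "0 < turn a p z" using pos by (simp add: zero_less_mult_iff)
  then show ?thesis using assms(2) C by simp
qed

lemma bent_replace_last:
  assumes "chain (x # C @ [b, y])" "bent 1 (x # C @ [y])" "C \<noteq> []" "turn (last C) b y < 0"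
  shows "bent 1 (x # C @ [b])"
proof -
  obtain M p z where C: "x # C = M @ [p, z]" "last C = z"
  proof -
    obtain C' z where "C = C' @ [z]" using assms(3) by (cases C rule: rev_cases) auto
    moreover obtain M p where "x # C' = M @ [p]" by (cases "x # C'" rule: rev_cases) auto
    ultimately show thesis using that[of M p z] by (metis append_Cons append_assoc append_Nil last_snoc)
  qed
  have "chain ((x # C) @ [b, y])" using assms(1) by simp
  then have pos: "0 < det2 p z" "0 < det2 z b" "0 < det2 z y" unfolding C(1) by auto
  have "bent 1 ((x # C) @ [y])" using assms(2) by simp
  then have b: "bent 1 (M @ [p, z])" "0 < turn p z y"
    unfolding C(1) using bent_snoc[of 1 M p z y] by auto
  then have "0 < det2 z y * turn p z b"
    using turn_exchange_left[of p z y b] pos assms(4) C(2) mult_pos_pos[of "turn p z y" "det2 z b"]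
      mult_pos_neg[of "det2 p z" "turn z b y"] by simp
  then have "0 < turn p z b" using pos by (simp add: zero_less_mult_iff)
  then have "bent 1 ((x # C) @ [b])" unfolding C(1) using b bent_snoc[of 1 M p z b] by simp
  then show ?thesis by simp
qed

lemma valley_count_le: "valley_count L \<le> length L - 2"
  by (induction L rule: valley_count.induct) auto

text \<open>The run contributes at most one valley per element; \<open>t\<close> is the vertex after \<open>y\<close>, if there is one, and
  tells that \<open>y\<close> itself is not a valley.\<close>

lemma valley_count_valley:
  assumes "length t \<le> 1" "t = [] \<or> \<not> turn (last (x # A)) y (hd t) < 0"
  shows "valley_count (x # A @ y # t) \<le> length A"
proof (cases t)
  case Nil
  then show ?thesis using valley_count_le[of "x # A @ [y]"] by simp
next
  case (Cons z t')
  then have t: "t = [z]" "\<not> turn (last (x # A)) y z < 0" using assms by auto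
  obtain M p where M: "x # A = M @ [p]" by (cases "x # A" rule: rev_cases) auto
  have "valley_count (x # A @ y # t) = valley_count (M @ [p, y, z])"
    using arg_cong[OF M, of "\<lambda>l. valley_count (l @ [y, z])"] t by simp
  also have "\<dots> = valley_count (M @ [p, y])" using valley_count_snoc[of M p y z] t(2) unfolding M by simp
  also have "\<dots> \<le> length (M @ [p, y]) - 2" by (rule valley_count_le)
  also have "\<dots> = length A" using arg_cong[OF M, of length] by simp
  finally show ?thesis .
qed

text \<open>The setting of a bypass: between \<open>x\<close> and \<open>y\<close> there are a run of valleys \<open>A0 a\<close>, the peaks \<open>C\<close>, and a
  run of valleys \<open>b B0\<close>, and the elements of \<open>C\<close> are still peaks after both runs have been removed.\<close>

context
  fixes V x A0 a C b B0 y
  assumes V: "set (x # A0 @ a # C @ b # B0 @ [y]) \<subseteq> V"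
    and ch: "chain (x # A0 @ a # C @ b # B0 @ [y])" and C: "C \<noteq> []"
    and left: "bent (-1) (x # A0 @ [a, hd C])" and right: "bent (-1) (last C # b # B0 @ [y])"
    and top: "bent 1 (x # C @ [y])"
    and pts: "\<And>v. v \<in> V \<Longrightarrow> 0 < det2 x v \<Longrightarrow> 0 < det2 v y \<Longrightarrow> v \<in> set (A0 @ a # C @ b # B0)"
begin

text \<open>Whether \<open>a\<close> is still a valley in the chain \<open>x A0 a b B0 y\<close> that skips \<open>C\<close>; likewise for \<open>b\<close> below.\<close>

definition "bypass_left \<longleftrightarrow> turn (last (x # A0)) a b < 0"
definition "bypass_right \<longleftrightarrow> turn a b (hd (B0 @ [y])) < 0"

lemma bypass_left_turn: "turn x a (hd C) < 0"
proof -
  have "chain (x # (A0 @ [a]) @ [hd C])" using ch C by (cases C) auto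
  then have "turning (-1) (x # (A0 @ [a]) @ [hd C])" using left by (intro bent_turning) auto
  then show ?thesis by (auto simp: sorted_wrt_append)
qed

lemma bypass_right_turn: "turn (last C) b y < 0"
proof -
  have "chain (last C # (b # B0) @ [y])" using ch C by auto
  then have "turning (-1) (last C # (b # B0) @ [y])" using right by (intro bent_turning) auto
  then show ?thesis by (auto simp: sorted_wrt_append)
qed

lemma bypass_tops: "bent 1 (a # C @ [y])" "bent 1 (x # C @ [b])" "bent 1 (a # C @ [b])"
proof -
  have c: "chain (x # a # C @ [y])" "chain (x # C @ [b, y])" "chain (a # C @ [b, y])" using ch by auto
  show 1: "bent 1 (a # C @ [y])"
    by (rule bent_replace_first[OF c(1) top C bypass_left_turn])
  show "bent 1 (x # C @ [b])"
    by (rule bent_replace_last[OF c(2) top C bypass_right_turn])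
  show "bent 1 (a # C @ [b])"
    by (rule bent_replace_last[OF c(3) 1 C bypass_right_turn])
qed

lemma bypass_window:
  assumes "x' \<in> set (x # A0 @ a # C)" "y' \<in> set (C @ b # B0 @ [y])" "0 < det2 x' y'"
    and v: "v \<in> V" "0 < det2 x' v" "0 < det2 v y'"
  shows "v \<in> set (A0 @ a # C @ b # B0)" "det2 v x' < 0" "det2 y' v < 0"
proof -
  have "0 \<le> det2 x x'" "0 < det2 x y'" "0 < det2 x' y" "0 \<le> det2 y' y"
    using assms(1,2) ch by (auto simp: less_imp_le)
  moreover have "det2 x' y' * det2 x v = det2 v y' * det2 x x' + det2 x' v * det2 x y'"
    "det2 x' y' * det2 v y = det2 v y' * det2 x' y + det2 x' v * det2 y' y"
    by (simp_all add: det2_def algebra_simps)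
  ultimately have "0 < det2 x' y' * det2 x v" "0 < det2 x' y' * det2 v y"
    using v by (simp_all add: add_nonneg_pos add_pos_nonneg)
  then have "0 < det2 x v" "0 < det2 v y" using assms(3) by (simp_all add: zero_less_mult_iff)
  then show "v \<in> set (A0 @ a # C @ b # B0)" by (rule pts[OF v(1)])
  show "det2 v x' < 0" "det2 y' v < 0" using v by (simp_all add: det2_swap[of v x'] det2_swap[of y' v])
qed

text \<open>The skipped peaks lie beyond the new edge \<open>a b\<close>, as \<open>partition_slabs\<close> requires of the points that
  the bottom chain leaves out.\<close>

lemma bypass_above: "v \<in> set C \<Longrightarrow> det2 a b \<le> det2 a v + det2 v b"
proof -
  assume v: "v \<in> set C"
  have "turning 1 (a # C @ [b])" using ch bypass_tops by (intro bent_turning) auto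
  then have "0 < turn a v b" using v by (auto simp: sorted_wrt_append)
  then show ?thesis by (simp add: turn_def)
qed

lemma bypass_valley_count:
  assumes "length t \<le> 1" "t = [] \<or> \<not> turn (last (b # B0)) y (hd t) < 0"
  shows "valley_count (x # A0 @ a # b # B0 @ y # t) + (if bypass_left then 0 else 1) + (if bypass_right then 0 else 1)
    \<le> length A0 + length B0 + 2"
proof -
  have 1: "valley_count (x # A0 @ a # b # B0 @ y # t) = valley_count (x # A0 @ [a, b]) + valley_count (a # b # B0 @ y # t)"
    using valley_count_append[of "x # A0" a b "B0 @ y # t"] by simp
  obtain M p where M: "x # A0 = M @ [p]" by (cases "x # A0" rule: rev_cases) auto
  have "valley_count (x # A0 @ [a, b]) = valley_count (M @ [p, a, b])"
    using arg_cong[OF M, of "\<lambda>l. valley_count (l @ [a, b])"] by simp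
  also have "\<dots> = valley_count (M @ [p, a]) + (if bypass_left then 1 else 0)"
    using valley_count_snoc[of M p a b] unfolding bypass_left_def M by simp
  also have "M @ [p, a] = x # A0 @ [a]" using M by simp
  finally have 2: "valley_count (x # A0 @ [a, b]) \<le> length A0 + (if bypass_left then 1 else 0)"
    using valley_count_le[of "x # A0 @ [a]"] by simp
  have "valley_count (a # b # B0 @ y # t) = (if bypass_right then 1 else 0) + valley_count (b # B0 @ y # t)"
    unfolding bypass_right_def by (cases B0) auto
  then have 3: "valley_count (a # b # B0 @ y # t) \<le> length B0 + (if bypass_right then 1 else 0)"
    using valley_count_valley[OF assms] by simp
  show ?thesis using 1 2 3 by (auto split: if_splits)
qed

text \<open>One polygon lies directly below \<open>C\<close>. It reaches down to \<open>x\<close> if \<open>a\<close> is still a valley, and only to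
  \<open>a\<close> otherwise; in the second case a further polygon \<open>x A0 a hd C\<close> remains. The right side is analogous.
  Each additional polygon is balanced by the valley that disappeared in \<open>bypass_valley_count\<close>.\<close>

lemma bypass_partition:
  assumes p: "partition_under V N (al @ x # A0 @ a # b # B0 @ y # be)"
    and c: "chain (al @ x # A0 @ a # C @ b # B0 @ y # be)"
  shows "partition_under V (N + 1 + (if bypass_left then 0 else 1) + (if bypass_right then 0 else 1))
     (al @ x # C @ y # be)"
proof -
  have vtx: "v \<in> under (x' # W @ [y'])" if "chain (x' # W @ [y'])" "v \<in> set W" for v x' W y'
    using under_vertex[OF that(1)] that(2) by auto
  \<comment> \<open>A run of valleys stays a cup after its end is redirected to the other run, if that end is still a valley.\<close>
  have bl: "bent (-1) (x # A0 @ [a, b])" if bypass_left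
  proof -
    obtain M p where M: "x # A0 = M @ [p]" by (cases "x # A0" rule: rev_cases) auto
    have "bent (-1) ((x # A0) @ [a])"
    proof -
      have "bent (-1) ((x # A0) @ [a, hd C])" using left by simp
      then show ?thesis unfolding M using bent_snoc[of "-1" M p a "hd C"] by simp
    qed
    then have "bent (-1) ((x # A0) @ [a, b])"
      using that bent_snoc[of "-1" M p a b] unfolding bypass_left_def M by simp
    then show ?thesis by simp
  qed
  have br: "bent (-1) (a # b # B0 @ [y])" if bypass_right
    using that right unfolding bypass_right_def by (cases B0) auto
  note tops = top bypass_tops
  have sep: "\<forall>u\<in>set A0. 0 < det2 u a" "\<forall>u\<in>set C. 0 < det2 u b" "\<forall>u\<in>set B0. 0 < det2 b u"
    "\<forall>u\<in>set C. 0 < det2 a u" 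
    using ch by auto
  \<comment> \<open>The number of pieces with the polygon below \<open>C\<close>, and after completing the left side.\<close>
  define N1 N2 where "N1 = Suc N" and "N2 = (if bypass_left then N1 else Suc N1)"
  define R where "R = (if bypass_right then [y] else b # B0 @ [y])"
  have cR: "chain (al @ x # A0 @ a # C @ R @ be)"
    using c by (auto simp: R_def)
  have "partition_under V N1 (al @ (if bypass_left then [x] else x # A0 @ [a]) @ C @ R @ be)"
  proof (cases bypass_left; cases bypass_right)
    assume l: bypass_left and r: bypass_right
    have b: "bent (-1) (x # (A0 @ a # b # B0) @ [y])"
      using bent_join[of "-1" "x # A0" a b "B0 @ [y]"] bl[OF l] br[OF r] by simp
    have c1: "chain (x # (A0 @ a # b # B0) @ [y])" using ch by auto
    have "v \<in> set C \<union> under (x # (A0 @ a # b # B0) @ [y])" if "v \<in> V" "0 < det2 x v" "0 < det2 v y" for v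
      using pts[OF that] vtx[OF c1, of v] by auto
    then have "partition_under V (Suc N) (al @ x # C @ y # be)"
      using p c b tops V C
      by (intro partition_step[of V N al x "A0 @ a # b # B0" y be C]) auto
    then show ?thesis using l r by (simp add: N1_def R_def)
  next
    assume l: bypass_left and r: "\<not> bypass_right"
    have b: "bent (-1) (x # (A0 @ [a]) @ [b])" using bl[OF l] by simp
    have c1: "chain (x # (A0 @ [a]) @ [b])" using ch by auto
    have "v \<in> set C \<union> under (x # (A0 @ [a]) @ [b])" if "v \<in> V" "0 < det2 x v" "0 < det2 v b" for v
    proof -
      have mem: "x \<in> set (x # A0 @ a # C)" "b \<in> set (C @ b # B0 @ [y])" "0 < det2 x b"
        using ch by auto
      note w = bypass_window[OF mem that]
      show ?thesis using w sep vtx[OF c1, of v] by auto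
    qed
    then have "partition_under V (Suc N) (al @ x # C @ b # B0 @ y # be)"
      using p c b tops V C
      by (intro partition_step[of V N al x "A0 @ [a]" b "B0 @ y # be" C]) auto
    then show ?thesis using l r by (simp add: N1_def R_def)
  next
    assume l: "\<not> bypass_left" and r: bypass_right
    have b: "bent (-1) (a # (b # B0) @ [y])" using br[OF r] by simp
    have c1: "chain (a # (b # B0) @ [y])" using ch by auto
    have "v \<in> set C \<union> under (a # (b # B0) @ [y])" if "v \<in> V" "0 < det2 a v" "0 < det2 v y" for v
    proof -
      have mem: "a \<in> set (x # A0 @ a # C)" "y \<in> set (C @ b # B0 @ [y])" "0 < det2 a y"
        using ch by auto
      note w = bypass_window[OF mem that]
      show ?thesis using w sep vtx[OF c1, of v] by auto
    qed
    then have "partition_under V (Suc N) ((al @ x # A0) @ a # C @ y # be)"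
      using p c b tops V C
      by (intro partition_step[of V N "al @ x # A0" a "b # B0" y be C]) auto
    then show ?thesis using l r by (simp add: N1_def R_def)
  next
    assume l: "\<not> bypass_left" and r: "\<not> bypass_right"
    have "v \<in> set C" if "v \<in> V" "0 < det2 a v" "0 < det2 v b" for v
    proof -
      have mem: "a \<in> set (x # A0 @ a # C)" "b \<in> set (C @ b # B0 @ [y])" "0 < det2 a b"
        using ch by auto
      note w = bypass_window[OF mem that]
      show ?thesis using w sep by auto
    qed
    then have "v \<in> set C \<union> under (a # [] @ [b])" if "v \<in> V" "0 < det2 a v" "0 < det2 v b" for v
      using that by blast
    then have "partition_under V (Suc N) ((al @ x # A0) @ a # C @ b # B0 @ y # be)"
      by (rule partition_step[of V N "al @ x # A0" a "[]" b "B0 @ y # be" C, rotated 7])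
        (use p c tops V C in auto)
    then show ?thesis using l r by (simp add: N1_def R_def)
  qed
  then have "partition_under V N2 (al @ x # C @ R @ be)"
  proof (cases bypass_left)
    case False
    assume mid: "partition_under V N1 (al @ (if bypass_left then [x] else x # A0 @ [a]) @ C @ R @ be)"
    obtain d C' where C': "C = d # C'" using C by (cases C) auto
    have c1: "chain (x # (A0 @ [a]) @ [d])" using ch C' by auto
    have "v \<in> under (x # (A0 @ [a]) @ [d])" if "v \<in> V" "0 < det2 x v" "0 < det2 v d" for v
    proof -
      have mem: "x \<in> set (x # A0 @ a # C)" "d \<in> set (C @ b # B0 @ [y])" "0 < det2 x d"
        using ch C' by auto
      note w = bypass_window[OF mem that]
      have "\<forall>u\<in>set C'. 0 < det2 d u" "\<forall>u\<in>set B0. 0 < det2 d u" using ch C' by auto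
      then show ?thesis using w sep vtx[OF c1, of v] C' by auto
    qed
    then have "partition_under V (Suc N1) (al @ x # d # C' @ R @ be)"
      by (rule partition_cut_valley[of V N1 al x "A0 @ [a]" d "C' @ R @ be", rotated 5])
        (use mid False cR V C' left in simp_all)
    then show ?thesis using False C' by (simp add: N2_def)
  qed (simp add: N2_def)
  then have "partition_under V (if bypass_right then N2 else Suc N2) (al @ x # C @ y # be)"
  proof (cases bypass_right)
    case False
    assume mid: "partition_under V N2 (al @ x # C @ R @ be)"
    obtain d C' where C': "C = C' @ [d]" using C by (cases C rule: rev_cases) auto
    have c1: "chain (d # (b # B0) @ [y])" using ch C' by auto
    have "v \<in> under (d # (b # B0) @ [y])" if "v \<in> V" "0 < det2 d v" "0 < det2 v y" for v
    proof -
      have mem: "d \<in> set (x # A0 @ a # C)" "y \<in> set (C @ b # B0 @ [y])" "0 < det2 d y"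
        using ch C' by auto
      note w = bypass_window[OF mem that]
      have "\<forall>u\<in>set C'. 0 < det2 u d" "\<forall>u\<in>set A0. 0 < det2 u d" using ch C' by auto
      then show ?thesis using w sep vtx[OF c1, of v] C' by auto
    qed
    then have "partition_under V (Suc N2) ((al @ x # C') @ d # y # be)"
      by (rule partition_cut_valley[of V N2 "al @ x # C'" d "b # B0" y be, rotated 5])
        (use mid False c V C' right in \<open>simp_all add: R_def\<close>)
    then show ?thesis using False C' by simp
  qed (simp add: R_def)
  then show ?thesis by (simp add: N1_def N2_def split: if_splits)
qed

end

section \<open>Counting\<close>

text \<open>The position \<open>0\<close> is the end point of the chain of peaks, which has no sign; hence the condition \<open>0 < j\<close>.\<close>

fun marked_pairs :: "(nat \<Rightarrow> bool) \<Rightarrow> nat \<Rightarrow> nat" where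
  "marked_pairs t 0 = 0"
| "marked_pairs t (Suc j) = marked_pairs t j + (if 0 < j \<and> t j \<and> t (Suc j) then 1 else 0)"

text \<open>The gap \<open>j\<close> lies between the peaks \<open>j\<close> and \<open>j + 1\<close>, and \<open>gap j\<close> says that it contains valleys;
  \<open>t k\<close> says that the peak \<open>k\<close> is a valley in the chain of peaks. The predicate \<open>G j v\<close> means that the part up
  to the peak \<open>j\<close> can be built with excess \<open>v\<close> over the intended bound. A gap with valleys contributes \<open>1\<close>,
  an empty gap \<open>-1\<close>, and a bypass, which joins two nonempty gaps with only empty gaps between them and all
  peaks between them unmarked, another \<open>-3\<close>. Every marked pair allows \<open>3\<close> more.

  The scan distinguishes three states at a peak, each with its own bound on the excess: \<open>2\<close> if a bypass from
  an earlier unused gap is still possible, \<open>1\<close> if the peak is marked, and \<open>0\<close> otherwise. A nonempty gap in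
  the first state leads to a bypass and lowers the bound to \<open>0\<close>; a marked peak reached from the second state
  completes a marked pair.\<close>

lemma gap_scan:
  fixes G :: "nat \<Rightarrow> int \<Rightarrow> bool" and gap t :: "nat \<Rightarrow> bool"
  assumes start: "G 0 0"
    and adj: "\<And>j v. j < m \<Longrightarrow> \<not> gap j \<Longrightarrow> G j v \<Longrightarrow> G (Suc j) (v - 1)"
    and one: "\<And>j v. j < m \<Longrightarrow> gap j \<Longrightarrow> G j v \<Longrightarrow> G (Suc j) (v + 1)"
    and two: "\<And>i j v. i < j \<Longrightarrow> j < m \<Longrightarrow> gap i \<Longrightarrow> gap j \<Longrightarrow> (\<And>k. i < k \<Longrightarrow> k < j \<Longrightarrow> \<not> gap k) \<Longrightarrow>
       (\<And>k. i < k \<Longrightarrow> k \<le> j \<Longrightarrow> \<not> t k) \<Longrightarrow> G i v \<Longrightarrow> G (Suc j) (v - (int j - int i))"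
    and m: "0 < m"
  shows "\<exists>v. G m v \<and> v \<le> 2 + 3 * int (marked_pairs t (m - 1))"
proof -
  define q where "q j = 3 * int (marked_pairs t j)" for j
  define closed where "closed j \<longleftrightarrow> (\<exists>v. G j v \<and> v \<le> q j) \<and> (j = 0 \<or> \<not> t j)" for j
  define marked where "marked j \<longleftrightarrow> (\<exists>v. G j v \<and> v \<le> 1 + q j) \<and> 0 < j \<and> t j" for j
  define opened where "opened j \<longleftrightarrow> (\<exists>v. G j v \<and> v \<le> 2 + q j) \<and>
      (\<exists>i v. i < j \<and> gap i \<and> (\<forall>k. i < k \<and> k < j \<longrightarrow> \<not> gap k) \<and> (\<forall>k. i < k \<and> k \<le> j \<longrightarrow> \<not> t k) \<and>
         G i v \<and> v - (int j - int i) \<le> q j)" for j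
  have q: "q (Suc j) = q j + (if 0 < j \<and> t j \<and> t (Suc j) then 3 else 0)" for j
    by (simp add: q_def)
  have step: "closed (Suc j) \<or> marked (Suc j) \<or> opened (Suc j)"
    if j: "j < m" and inv: "closed j \<or> marked j \<or> opened j" for j
    using inv
  proof (elim disjE)
    assume c: "closed j"
    then obtain v where v: "G j v" "v \<le> q j" by (auto simp: closed_def)
    have q': "q (Suc j) = q j" using c by (auto simp: q closed_def)
    show ?thesis
    proof (cases "gap j")
      case True
      have g: "G (Suc j) (v + 1)" using one j True v by blast
      show ?thesis
      proof (cases "t (Suc j)")
        case True
        then have "marked (Suc j)" unfolding marked_def using g v q' by (auto intro!: exI[of _ "v + 1"])
        then show ?thesis by blast
      next
        case False
        have "\<exists>w. G (Suc j) w \<and> w \<le> 2 + q (Suc j)" using g v q' by (intro exI[of _ "v + 1"]) auto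
        moreover have "\<exists>i v. i < Suc j \<and> gap i \<and> (\<forall>k. i < k \<and> k < Suc j \<longrightarrow> \<not> gap k) \<and>
          (\<forall>k. i < k \<and> k \<le> Suc j \<longrightarrow> \<not> t k) \<and> G i v \<and> v - (int (Suc j) - int i) \<le> q (Suc j)"
          using True False v q' by (intro exI[of _ j] exI[of _ v]) (auto simp: le_Suc_eq)
        ultimately show ?thesis unfolding opened_def by blast
      qed
    next
      case False
      then have g: "G (Suc j) (v - 1)" using adj j v by blast
      show ?thesis using g v q' unfolding closed_def marked_def
        by (cases "t (Suc j)") (auto intro!: exI[of _ "v - 1"])
    qed
  next
    assume c: "marked j"
    then obtain v where v: "G j v" "v \<le> 1 + q j" by (auto simp: marked_def)
    have q': "q (Suc j) = q j + (if t (Suc j) then 3 else 0)" using c by (auto simp: q marked_def)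
    show ?thesis
    proof (cases "gap j")
      case True
      have g: "G (Suc j) (v + 1)" using one j True v by blast
      show ?thesis
      proof (cases "t (Suc j)")
        case True
        then have "marked (Suc j)" unfolding marked_def using g v q' by (auto intro!: exI[of _ "v + 1"])
        then show ?thesis by blast
      next
        case False
        have "\<exists>w. G (Suc j) w \<and> w \<le> 2 + q (Suc j)" using g v q' False by (intro exI[of _ "v + 1"]) auto
        moreover have "\<exists>i v. i < Suc j \<and> gap i \<and> (\<forall>k. i < k \<and> k < Suc j \<longrightarrow> \<not> gap k) \<and>
          (\<forall>k. i < k \<and> k \<le> Suc j \<longrightarrow> \<not> t k) \<and> G i v \<and> v - (int (Suc j) - int i) \<le> q (Suc j)"
          using True False v q' by (intro exI[of _ j] exI[of _ v]) (auto simp: le_Suc_eq)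
        ultimately show ?thesis unfolding opened_def by blast
      qed
    next
      case False
      then have g: "G (Suc j) (v - 1)" using adj j v by blast
      show ?thesis using g v q' unfolding closed_def marked_def
        by (cases "t (Suc j)") (auto intro!: exI[of _ "v - 1"])
    qed
  next
    assume c: "opened j"
    then obtain v where v: "G j v" "v \<le> 2 + q j" by (auto simp: opened_def)
    obtain i w where i: "i < j" "gap i" "\<And>k. i < k \<Longrightarrow> k < j \<Longrightarrow> \<not> gap k" "\<And>k. i < k \<Longrightarrow> k \<le> j \<Longrightarrow> \<not> t k"
       "G i w" "w - (int j - int i) \<le> q j"
      using c unfolding opened_def by blast
    have q': "q (Suc j) = q j" using i(1) i(4)[of j] by (auto simp: q)
    show ?thesis
    proof (cases "gap j")
      case True
      have g: "G (Suc j) (w - (int j - int i))"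
        using two[of i j w] i j True by blast
      show ?thesis using g i(6) q' unfolding closed_def marked_def
        by (cases "t (Suc j)") (auto intro!: exI[of _ "w - (int j - int i)"])
    next
      case False
      then have g: "G (Suc j) (v - 1)" using adj j v by blast
      show ?thesis
      proof (cases "t (Suc j)")
        case True
        then have "marked (Suc j)" unfolding marked_def using g v q' by (auto intro!: exI[of _ "v - 1"])
        then show ?thesis by blast
      next
        case nt: False
        have "\<exists>w. G (Suc j) w \<and> w \<le> 2 + q (Suc j)" using g v q' by (intro exI[of _ "v - 1"]) auto
        moreover have "\<exists>i v. i < Suc j \<and> gap i \<and> (\<forall>k. i < k \<and> k < Suc j \<longrightarrow> \<not> gap k) \<and>
          (\<forall>k. i < k \<and> k \<le> Suc j \<longrightarrow> \<not> t k) \<and> G i v \<and> v - (int (Suc j) - int i) \<le> q (Suc j)"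
          using False nt i q' by (intro exI[of _ i] exI[of _ w]) (auto simp: le_Suc_eq less_Suc_eq)
        ultimately show ?thesis unfolding opened_def by blast
      qed
    qed
  qed
  have inv: "closed j \<or> marked j \<or> opened j" if "j \<le> m" for j
    using that
  proof (induction j)
    case 0
    then show ?case using start by (auto simp: closed_def q_def)
  qed (use step in auto)
  have j: "m - 1 < m" "Suc (m - 1) = m" using m by auto
  have "\<exists>v. G m v \<and> v \<le> 2 + q (m - 1)"
    using inv[of "m - 1", OF diff_le_self]
  proof (elim disjE)
    assume "closed (m - 1)"
    then obtain v where "G (m - 1) v" "v \<le> q (m - 1)" by (auto simp: closed_def)
    then show ?thesis using one[of "m - 1" v] adj[of "m - 1" v] j by (cases "gap (m - 1)") force+
  next
    assume "marked (m - 1)"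
    then obtain v where "G (m - 1) v" "v \<le> 1 + q (m - 1)" by (auto simp: marked_def)
    then show ?thesis using one[of "m - 1" v] adj[of "m - 1" v] j by (cases "gap (m - 1)") force+
  next
    assume c: "opened (m - 1)"
    then obtain v where v: "G (m - 1) v" "v \<le> 2 + q (m - 1)" by (auto simp: opened_def)
    obtain i w where i: "i < m - 1" "gap i" "\<And>k. i < k \<Longrightarrow> k < m - 1 \<Longrightarrow> \<not> gap k"
       "\<And>k. i < k \<Longrightarrow> k \<le> m - 1 \<Longrightarrow> \<not> t k"
       "G i w" "w - (int (m - 1) - int i) \<le> q (m - 1)"
      using c unfolding opened_def by blast
    show ?thesis
    proof (cases "gap (m - 1)")
      case True
      have "G (Suc (m - 1)) (w - (int (m - 1) - int i))"
        using two[of i "m - 1" w] i j True by blast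
      then show ?thesis using i(6) j by force
    next
      case False
      then show ?thesis using adj[of "m - 1" v] v j by force
    qed
  qed
  then show ?thesis by (simp add: q_def)
qed

section \<open>Alternating runs of valleys and peaks\<close>

lemma edges_tight:
  assumes "chain L" "(a, b) \<in> edges L" "p \<in> set L" "wedge a b p"
  shows "p = a \<or> p = b"
  using assms
proof (induction L)
  case (Cons d L)
  show ?case
  proof (cases L)
    case (Cons e M)
    show ?thesis
    proof (cases "(a, b) = (d, e)")
      case True
      then show ?thesis
        using Cons.prems Cons by (force simp: wedge_def det2_swap[of p])
    next
      case False
      then have e: "(a, b) \<in> edges L" using Cons.prems Cons by auto
      show ?thesis
      proof (cases "p \<in> set L")
        case True
        then show ?thesis using Cons.IH Cons.prems e by auto
      next
        case False
        then have "p = d" using Cons.prems by auto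
        moreover have "0 < det2 d a" using Cons.prems edges_subset[OF e] by auto
        ultimately show ?thesis using Cons.prems(4) by (simp add: wedge_def det2_swap[of a])
      qed
    qed
  qed (use Cons.prems in auto)
qed simp

lemma chain_between:
  assumes "chain (al @ x # W @ y # be)" "v \<in> set (al @ x # W @ y # be)" "0 < det2 x v" "0 < det2 v y"
  shows "v \<in> set W"
proof -
  have n: "det2 v x < 0" "det2 y v < 0" using assms(3,4) by (simp_all add: det2_swap[of v x] det2_swap[of y v])
  have "\<forall>u\<in>set al. 0 < det2 u x" "\<forall>u\<in>set be. 0 < det2 y u" using assms(1) by auto
  then have "v \<notin> set al" "v \<notin> set be" using n by fastforce+
  moreover have "v \<noteq> x" "v \<noteq> y" using assms(3,4) by auto
  ultimately show ?thesis using assms(2) by auto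
qed

lemma chain_distinct: "chain L \<Longrightarrow> distinct L"
  by (induction L) auto

lemma valley_pairs_snoc:
  "valley_pairs (L @ [a, b, c, d]) = valley_pairs (L @ [a, b, c]) +
     (if turn a b c < 0 \<and> turn b c d < 0 then 1 else 0)"
proof (induction L)
  case (Cons z L)
  then show ?case
    by (cases L rule: list.exhaust; cases "tl L" rule: list.exhaust; cases "tl (tl L)") auto
qed simp

text \<open>The points strictly after the peak \<open>c i\<close> up to and including \<open>c j\<close>, where \<open>A k\<close> lists the valleys
  between \<open>c k\<close> and \<open>c (k + 1)\<close>.\<close>

definition blocks :: "(nat \<Rightarrow> pt) \<Rightarrow> (nat \<Rightarrow> pt list) \<Rightarrow> nat \<Rightarrow> nat \<Rightarrow> pt list" where
  "blocks c A i j = concat (map (\<lambda>k. A k @ [c (Suc k)]) [i..<j])"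

lemma blocks_same [simp]: "blocks c A i i = []"
  by (simp add: blocks_def)

lemma blocks_Suc: "i \<le> j \<Longrightarrow> blocks c A i (Suc j) = blocks c A i j @ A j @ [c (Suc j)]"
  by (simp add: blocks_def)

lemma blocks_Cons: "i < j \<Longrightarrow> blocks c A i j = A i @ c (Suc i) # blocks c A (Suc i) j"
  by (simp add: blocks_def upt_conv_Cons)

lemma blocks_append: "i \<le> j \<Longrightarrow> j \<le> k \<Longrightarrow> blocks c A i k = blocks c A i j @ blocks c A j k"
  unfolding blocks_def using upt_add_eq_append[of i j "k - j"] by simp

lemma blocks_last: "i \<le> j \<Longrightarrow> \<exists>M. c i # blocks c A i j = M @ [c j]"
proof (cases "i = j")
  case False
  assume "i \<le> j"
  then obtain k where "j = Suc k" "i \<le> k" using False by (cases j) auto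
  then have "c i # blocks c A i j = (c i # blocks c A i k @ A k) @ [c j]" by (simp add: blocks_Suc)
  then show ?thesis by blast
qed simp

lemma parse_blocks:
  assumes "L \<noteq> []"
  shows "\<exists>c A m. 0 < m \<and> c 0 = x \<and> L = blocks c A 0 m \<and>
    (\<forall>j<m. bent (-1) (c j # A j @ [c (Suc j)])) \<and>
    (\<forall>j. Suc j < m \<longrightarrow> \<not> turn (last (c j # A j)) (c (Suc j)) (hd (A (Suc j) @ [c (Suc (Suc j))])) < 0)"
  using assms
proof (induction L arbitrary: x rule: length_induct)
  case (1 L)
  obtain run y rest where r: "L = run @ y # rest" "bent (-1) (x # run @ [y])"
    "rest = [] \<or> \<not> turn (last (x # run)) y (hd rest) < 0"
    using maximal_valley[OF 1(2)] by blast
  show ?case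
  proof (cases "rest = []")
    case True
    show ?thesis
      using r True by (intro exI[of _ "case_nat x (\<lambda>_. y)"] exI[of _ "\<lambda>_. run"] exI[of _ 1])
        (auto simp: blocks_def)
  next
    case False
    have "length rest < length L" using r by simp
    then obtain c A m where IH: "0 < m" "c 0 = y" "rest = blocks c A 0 m"
      "\<forall>j<m. bent (-1) (c j # A j @ [c (Suc j)])"
      "\<forall>j. Suc j < m \<longrightarrow> \<not> turn (last (c j # A j)) (c (Suc j)) (hd (A (Suc j) @ [c (Suc (Suc j))])) < 0"
      using 1(1) False by blast
    define c' A' where "c' = case_nat x c" and "A' = case_nat run A"
    have "blocks c' A' (Suc 0) (Suc m) = blocks c A 0 m"
      unfolding blocks_def by (simp add: map_Suc_upt[symmetric] c'_def A'_def comp_def del: upt_Suc)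
    then have "L = blocks c' A' 0 (Suc m)"
      using r(1) IH(2,3) blocks_Cons[of 0 "Suc m" c' A'] by (simp add: c'_def A'_def)
    moreover have "bent (-1) (c' j # A' j @ [c' (Suc j)])" if "j < Suc m" for j
      using that IH(2,4) r(2) by (cases j) (auto simp: c'_def A'_def)
    moreover have "\<not> turn (last (c' j # A' j)) (c' (Suc j)) (hd (A' (Suc j) @ [c' (Suc (Suc j))])) < 0"
      if "Suc j < Suc m" for j
    proof (cases j)
      case 0
      have "hd rest = hd (A 0 @ [c 1])"
        using IH(1,3) blocks_Cons[of 0 m c A] by (cases "A 0") auto
      then show ?thesis using 0 r(3) False IH(2) by (simp add: c'_def A'_def)
    next
      case (Suc i)
      then show ?thesis using IH(5) that by (auto simp: c'_def A'_def)
    qed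
    ultimately show ?thesis
      by (intro exI[of _ c'] exI[of _ A'] exI[of _ "Suc m"]) (auto simp: c'_def)
  qed
qed

text \<open>The sequence of all points except the origin, split into peaks \<open>c k\<close> (including the two ends) and
  possibly empty runs \<open>A k\<close> of valleys.\<close>

locale valley_blocks =
  fixes V :: "pt set" and c :: "nat \<Rightarrow> pt" and A :: "nat \<Rightarrow> pt list" and m :: nat
  assumes no_three: "no_three V" and chain: "chain (c 0 # blocks c A 0 m)"
    and V: "V = set (c 0 # blocks c A 0 m)" and m: "0 < m"
    and valley: "j < m \<Longrightarrow> bent (-1) (c j # A j @ [c (Suc j)])"
    and peak: "Suc j < m \<Longrightarrow> \<not> turn (last (c j # A j)) (c (Suc j)) (hd (A (Suc j) @ [c (Suc (Suc j))])) < 0"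
begin

abbreviation "prefix j \<equiv> c 0 # blocks c A 0 j"

lemma prefix_split: "j \<le> m \<Longrightarrow> prefix m = prefix j @ blocks c A j m"
  using blocks_append[of 0 j m c A] by simp

lemma prefix_Suc: "prefix (Suc j) = prefix j @ A j @ [c (Suc j)]"
  by (simp add: blocks_Suc)

lemma prefix_snoc: "\<exists>M. prefix j = M @ [c j]"
  using blocks_last[of 0 j] by simp

lemma prefix_chain: "j \<le> m \<Longrightarrow> chain (prefix j) \<and> set (prefix j) \<subseteq> V"
proof -
  assume "j \<le> m"
  then have "chain (prefix j @ blocks c A j m)" "V = set (prefix j @ blocks c A j m)"
    using chain V by (simp_all only: prefix_split[symmetric])
  then show ?thesis by auto
qed

lemma prefix_block: "j < m \<Longrightarrow> \<exists>al be. prefix m = al @ c j # A j @ c (Suc j) # be"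
proof -
  assume j: "j < m"
  obtain M where "prefix j = M @ [c j]" using prefix_snoc by blast
  then have "prefix m = M @ c j # A j @ c (Suc j) # blocks c A (Suc j) m"
    using prefix_split[of j] blocks_Cons[of j m c A] j by simp
  then show ?thesis by blast
qed

lemma block_edges: "j < m \<Longrightarrow> edges (c j # A j @ [c (Suc j)]) \<subseteq> edges (prefix m)"
proof -
  assume "j < m"
  then obtain al be where prefix: "prefix m = al @ c j # A j @ c (Suc j) # be" using prefix_block by blast
  show ?thesis unfolding prefix
    using edges_append[of al "c j" "A j @ c (Suc j) # be"] edges_append[of "c j # A j" "c (Suc j)" be] by auto
qed

lemma edge_bound: "(a, b) \<in> edges (prefix m) \<Longrightarrow> v \<in> V \<Longrightarrow> wedge a b v \<Longrightarrow> det2 a b \<le> det2 a v + det2 v b"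
  using edges_tight[OF chain, of a b v] unfolding V by auto

lemma peaks_subset: "set (map c [0..<Suc j]) \<subseteq> set (prefix j)"
  by (induction j) (auto simp: blocks_Suc)

lemma peaks_chain: "j \<le> m \<Longrightarrow> chain (map c [0..<Suc j])"
proof (induction j)
  case (Suc j)
  have "\<forall>u\<in>set (prefix j). 0 < det2 u (c (Suc j))"
    using prefix_chain[of "Suc j"] Suc.prems unfolding prefix_Suc by auto
  then show ?case using Suc peaks_subset[of j] by auto
qed simp

text \<open>The first \<open>j + 1\<close> peaks may replace the first \<open>j + 1\<close> peaks with their valleys in front of any
  continuation.\<close>

lemma peaks_chain_append: "j \<le> m \<Longrightarrow> chain (prefix j @ r) \<Longrightarrow> chain (map c [0..<j] @ c j # r)"
  using peaks_chain[of j] peaks_subset[of j] by auto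

text \<open>The vertex after \<open>c j\<close> in the full chain, as a list so that it is empty at the end. Every bottom chain
  built below continues with it, so the sign of \<open>c j\<close> is known.\<close>

definition "next_point j = (if j < m then [hd (A j @ [c (Suc j)])] else [])"

text \<open>There is a bottom chain \<open>bs @ [c j]\<close> from which \<open>k\<close> polygons lead to the first \<open>j + 1\<close> peaks, in front of
  any continuation \<open>r\<close>. The left-hand side of the inequality collects the cuts to valleys, the polygons and
  the remaining length \<open>j + 1\<close>; the right-hand side grows by \<open>4\<close> per point. The constant \<open>-1\<close> makes the excess
  of a single point equal to \<open>0\<close>.\<close>

definition "has_excess j v \<longleftrightarrow> (\<exists>bs k.
    chain (bs @ [c j]) \<and> set bs \<subseteq> set (prefix j) \<and> (0 < j \<longrightarrow> bs \<noteq> []) \<and>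
    (\<forall>a b p. (a, b) \<in> edges (bs @ [c j]) \<longrightarrow> p \<in> V \<longrightarrow> wedge a b p \<longrightarrow> det2 a b \<le> det2 a p + det2 p b) \<and>
    3 * (int (valley_count (bs @ c j # next_point j)) + int k + int j + 1) \<le> 4 * int (length (prefix j)) - 1 + v \<and>
    (\<forall>r N. chain (prefix j @ r) \<longrightarrow> set r \<subseteq> V \<longrightarrow> partition_under V N (bs @ c j # r) \<longrightarrow>
       partition_under V (N + k) (map c [0..<j] @ c j # r)))"

lemma has_excess_start: "has_excess 0 0"
  unfolding has_excess_def by (intro exI[of _ "[]"] exI[of _ 0]) (auto simp: next_point_def)

lemma block_valley_count:
  assumes "j < m"
  shows "valley_count (bs @ c j # A j @ c (Suc j) # next_point (Suc j)) \<le> valley_count (bs @ c j # next_point j) + length (A j)"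
proof -
  have "valley_count (bs @ c j # A j @ c (Suc j) # next_point (Suc j)) =
      valley_count (bs @ c j # next_point j) + valley_count (c j # A j @ c (Suc j) # next_point (Suc j))"
    using assms valley_count_append[of bs "c j" "hd (A j @ [c (Suc j)])" "tl (A j @ c (Suc j) # next_point (Suc j))"]
    by (cases "A j") (auto simp: next_point_def)
  moreover have "valley_count (c j # A j @ c (Suc j) # next_point (Suc j)) \<le> length (A j)"
    using peak[of j] by (intro valley_count_valley) (auto simp: next_point_def)
  ultimately show ?thesis by simp
qed

lemma block_between: "j < m \<Longrightarrow> v \<in> V \<Longrightarrow> 0 < det2 (c j) v \<Longrightarrow> 0 < det2 v (c (Suc j)) \<Longrightarrow> v \<in> set (A j)"
  using prefix_block[of j] chain_between[of _ "c j" "A j" "c (Suc j)" _ v] chain unfolding V by metis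

text \<open>A run of \<open>k\<close> valleys and the next peak account for \<open>k\<close> cuts, one polygon and one more peak, against
  \<open>k + 1\<close> points: the excess grows by \<open>3 (k + 2) - 4 (k + 1) = 2 - k\<close>, which is at most \<open>1\<close>.\<close>

lemma has_excess_block:
  assumes j: "j < m" and r: "has_excess j v"
  shows "has_excess (Suc j) (v + (if A j = [] then - 1 else 1))"
proof -
  obtain bs k where b: "chain (bs @ [c j])" "set bs \<subseteq> set (prefix j)"
    "\<And>a b p. (a, b) \<in> edges (bs @ [c j]) \<Longrightarrow> p \<in> V \<Longrightarrow> wedge a b p \<Longrightarrow> det2 a b \<le> det2 a p + det2 p b"
    "3 * (int (valley_count (bs @ c j # next_point j)) + int k + int j + 1) \<le> 4 * int (length (prefix j)) - 1 + v"
    "\<And>r N. chain (prefix j @ r) \<Longrightarrow> set r \<subseteq> V \<Longrightarrow> partition_under V N (bs @ c j # r) \<Longrightarrow>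
       partition_under V (N + k) (map c [0..<j] @ c j # r)"
    using r unfolding has_excess_def by blast
  define k' where "k' = k + (if A j = [] then 0 else 1)"
  have FS: "chain (prefix j @ A j @ [c (Suc j)])" "set (prefix (Suc j)) \<subseteq> V"
    using prefix_chain[of "Suc j"] j unfolding prefix_Suc by auto
  obtain M where M: "prefix j = M @ [c j]" using prefix_snoc by blast
  have cj: "c j \<in> set (prefix j)" unfolding M by simp
  show ?thesis
    unfolding has_excess_def
  proof (intro exI[of _ "bs @ c j # A j"] exI[of _ k'] conjI allI impI)
    show "chain ((bs @ c j # A j) @ [c (Suc j)])"
      using b(1,2) FS(1) cj by auto
    show "set (bs @ c j # A j) \<subseteq> set (prefix (Suc j))"
      using b(2) cj unfolding prefix_Suc by auto
    show "bs @ c j # A j \<noteq> []" by simp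
  next
    fix a b' p
    assume "(a, b') \<in> edges ((bs @ c j # A j) @ [c (Suc j)])" "p \<in> V" "wedge a b' p"
    moreover have "edges ((bs @ c j # A j) @ [c (Suc j)]) \<subseteq> edges (bs @ [c j]) \<union> edges (prefix m)"
      using block_edges[OF j] edges_append[of bs "c j" "A j @ [c (Suc j)]"] by auto
    ultimately show "det2 a b' \<le> det2 a p + det2 p b'" using b(3) edge_bound by blast
  next
    have "valley_count ((bs @ c j # A j) @ c (Suc j) # next_point (Suc j)) \<le> valley_count (bs @ c j # next_point j) + length (A j)"
      using block_valley_count[OF j, of bs] by simp
    moreover have "A j \<noteq> [] \<Longrightarrow> 1 \<le> length (A j)" by (cases "A j") auto
    ultimately show "3 * (int (valley_count ((bs @ c j # A j) @ c (Suc j) # next_point (Suc j))) + int k' + int (Suc j) + 1)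
      \<le> 4 * int (length (prefix (Suc j))) - 1 + (v + (if A j = [] then - 1 else 1))"
      using b(4) unfolding prefix_Suc k'_def by auto
  next
    fix r N
    assume det2': "chain (prefix (Suc j) @ r)" and rV: "set r \<subseteq> V"
      and p: "partition_under V N ((bs @ c j # A j) @ c (Suc j) # r)"
    have ch: "chain (prefix j @ A j @ c (Suc j) # r)" using det2' unfolding prefix_Suc by simp
    have sV: "set (A j @ c (Suc j) # r) \<subseteq> V" using rV FS(2) unfolding prefix_Suc by auto
    have p1: "partition_under V (N + k) (map c [0..<j] @ c j # A j @ c (Suc j) # r)"
      using b(5)[OF ch sV] p by simp
    show "partition_under V (N + k') (map c [0..<Suc j] @ c (Suc j) # r)"
    proof (cases "A j = []")
      case True
      then show ?thesis using p1 by (simp add: k'_def)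
    next
      case False
      have ch2: "chain (map c [0..<j] @ c j # A j @ c (Suc j) # r)"
        using peaks_chain_append[OF _ ch] j by simp
      have "partition_under V (Suc (N + k)) (map c [0..<j] @ c j # c (Suc j) # r)"
      proof (rule partition_cut_valley[OF p1 ch2 valley[OF j] _ False])
        show "set (c j # A j @ [c (Suc j)]) \<subseteq> V" using FS(2) cj unfolding prefix_Suc by auto
        have "chain (c j # A j @ [c (Suc j)])" using FS(1) unfolding M by auto
        then show "u \<in> under (c j # A j @ [c (Suc j)])" if "u \<in> V" "0 < det2 (c j) u" "0 < det2 u (c (Suc j))" for u
          using block_between[OF j that] by (intro under_vertex) auto
      qed
      then show ?thesis using False by (simp add: k'_def)
    qed
  qed
qed

lemma blocks_empty: "i \<le> j \<Longrightarrow> (\<And>k. i \<le> k \<Longrightarrow> k < j \<Longrightarrow> A k = []) \<Longrightarrow> blocks c A i j = map c [Suc i..<Suc j]"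
proof (induction j)
  case (Suc j)
  show ?case
  proof (cases "i = Suc j")
    case False
    then have "i \<le> j" using Suc.prems by simp
    then show ?thesis using Suc by (simp add: blocks_Suc)
  qed simp
qed simp

lemma bent_peaks:
  assumes "\<And>k. i < k \<Longrightarrow> k \<le> j \<Longrightarrow> 0 < turn (c (k - 1)) (c k) (c (Suc k))" "i \<le> j"
  shows "bent 1 (map c [i..<Suc (Suc j)])"
  using assms
proof (induction j)
  case (Suc j)
  show ?case
  proof (cases "i = Suc j")
    case False
    then have "bent 1 (map c [i..<Suc (Suc j)])" using Suc by auto
    then show ?thesis
      using Suc.prems(1)[of "Suc j"] False Suc.prems(2) bent_snoc[of 1 "map c [i..<j]" "c j" "c (Suc j)" "c (Suc (Suc j))"]
      by auto
  qed auto
qed auto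

lemma peaks_det2: "p < q \<Longrightarrow> q \<le> m \<Longrightarrow> 0 < det2 (c p) (c q)"
  using peaks_chain[of m] unfolding chain_def sorted_wrt_iff_nth_less
  by (auto simp del: upt_Suc dest!: spec[of _ p] spec[of _ q])

lemma peaks_V: "p \<le> m \<Longrightarrow> c p \<in> V"
proof -
  assume "p \<le> m"
  then have "c p \<in> set (map c [0..<Suc m])" by (auto simp: le_less)
  then show ?thesis using peaks_subset[of m] prefix_chain[of m] by blast
qed

lemma peak_turn:
  assumes "0 < k" "k < m" "\<not> turn (c (k - 1)) (c k) (c (Suc k)) < 0"
  shows "0 < turn (c (k - 1)) (c k) (c (Suc k))"
proof -
  have "chain [c (k - 1), c k, c (Suc k)]"
    using assms peaks_det2[of "k - 1" k] peaks_det2[of k "Suc k"] peaks_det2[of "k - 1" "Suc k"] by auto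
  then have "turn (c (k - 1)) (c k) (c (Suc k)) \<noteq> 0"
    using assms peaks_V by (intro chain_turn_nonzero[OF no_three, of _ _ _ "[]"]) auto
  then show ?thesis using assms(3) by linarith
qed

text \<open>Here the peaks \<open>c (i + 1), ..., c j\<close> are adjacent points and stay peaks in the chain of peaks, so the
  bottom chain can skip all of them.\<close>

lemma has_excess_bypass:
  assumes ij: "i < j" "j < m" and A: "A i \<noteq> []" "A j \<noteq> []" "\<And>k. i < k \<Longrightarrow> k < j \<Longrightarrow> A k = []"
    and t: "\<And>k. i < k \<Longrightarrow> k \<le> j \<Longrightarrow> \<not> turn (c (k - 1)) (c k) (c (Suc k)) < 0"
    and r: "has_excess i v"
  shows "has_excess (Suc j) (v - (int j - int i))"
proof -
  obtain bs k where bk: "chain (bs @ [c i])" "set bs \<subseteq> set (prefix i)"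
    "\<And>a b p. (a, b) \<in> edges (bs @ [c i]) \<Longrightarrow> p \<in> V \<Longrightarrow> wedge a b p \<Longrightarrow> det2 a b \<le> det2 a p + det2 p b"
    "3 * (int (valley_count (bs @ c i # next_point i)) + int k + int i + 1) \<le> 4 * int (length (prefix i)) - 1 + v"
    "\<And>r N. chain (prefix i @ r) \<Longrightarrow> set r \<subseteq> V \<Longrightarrow> partition_under V N (bs @ c i # r) \<Longrightarrow>
       partition_under V (N + k) (map c [0..<i] @ c i # r)"
    using r unfolding has_excess_def by blast
  define x y C where "x = c i" and "y = c (Suc j)" and "C = map c [Suc i..<Suc j]"
  obtain A0 a where a: "A i = A0 @ [a]" using A(1) by (cases "A i" rule: rev_cases) auto
  obtain b B0 where b: "A j = b # B0" using A(2) by (cases "A j") auto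
  have C: "C \<noteq> []" "hd C = c (Suc i)" "last C = c j" "length C = j - i"
  proof -
    have u: "[Suc i..<Suc j] = Suc i # [Suc (Suc i)..<Suc j]" "[Suc i..<Suc j] = [Suc i..<j] @ [j]"
      using ij by (simp add: upt_conv_Cons del: upt_Suc) (rule upt_Suc_append, use ij in simp)
    show "C \<noteq> []" "hd C = c (Suc i)" unfolding C_def u(1) by simp_all
    show "last C = c j" unfolding C_def u(2) by simp
    show "length C = j - i" unfolding C_def length_map length_upt by simp
  qed
  have iC: "map c [0..<i] @ x # C = map c [0..<Suc j]"
  proof -
    have "[0..<Suc j] = [0..<i] @ [i..<Suc j]" using upt_add_eq_append[of 0 i "Suc j - i"] ij by simp
    then show ?thesis using ij by (simp add: C_def x_def upt_conv_Cons del: upt_Suc)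
  qed
  have FS: "prefix (Suc j) = prefix i @ A0 @ a # C @ b # B0 @ [y]"
  proof -
    have "blocks c A (Suc i) j = map c [Suc (Suc i)..<Suc j]"
      using A(3) ij by (intro blocks_empty) auto
    then have "blocks c A i j = A i @ C"
      using blocks_Cons[OF ij(1)] ij by (simp add: C_def upt_conv_Cons del: upt_Suc)
    then show ?thesis
      using blocks_append[of 0 i j c A] ij unfolding prefix_Suc by (simp add: a b y_def)
  qed
  obtain M where M: "prefix i = M @ [x]" using prefix_snoc[of i] by (auto simp: x_def)
  define be where "be = blocks c A (Suc j) m"
  have Fm: "prefix m = M @ x # (A0 @ a # C @ b # B0) @ y # be"
    using prefix_split[of "Suc j"] ij unfolding FS M be_def by simp
  have VM: "V = set (M @ x # (A0 @ a # C @ b # B0) @ y # be)" using V unfolding Fm .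
  have chM: "chain (M @ x # (A0 @ a # C @ b # B0) @ y # be)" using chain unfolding Fm .
  have hyp1: "set (x # A0 @ a # C @ b # B0 @ [y]) \<subseteq> V" unfolding VM by auto
  have hyp2: "chain (x # A0 @ a # C @ b # B0 @ [y])" using chM by auto
  have hyp3: "bent (- 1) (x # A0 @ [a, hd C])"
    using valley[of i] ij by (simp add: a C x_def)
  have hyp4: "bent (- 1) (last C # b # B0 @ [y])"
    using valley[of j] ij by (simp add: b C y_def)
  have hyp5: "bent 1 (x # C @ [y])"
  proof -
    have "bent 1 (map c [i..<Suc (Suc j)])"
      using ij t by (intro bent_peaks peak_turn) auto
    also have "[i..<Suc (Suc j)] = i # [Suc i..<Suc j] @ [Suc j]"
      using ij by (simp add: upt_conv_Cons)
    finally show ?thesis by (simp add: x_def y_def C_def)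
  qed
  have hyp6: "u \<in> set (A0 @ a # C @ b # B0)" if "u \<in> V" "0 < det2 x u" "0 < det2 u y" for u
    using chain_between[OF chM] that unfolding VM by blast
  note hyp = hyp1 hyp2 C(1) hyp3 hyp4 hyp5 hyp6
  define f where "f = (if bypass_left x A0 a b then 0 else 1::nat) + (if bypass_right a b B0 y then 0 else 1)"
  have xF: "x \<in> set (prefix i)" unfolding M by simp
  have chS: "chain (prefix i @ A0 @ a # C @ b # B0 @ [y])"
    using prefix_chain[of "Suc j"] ij unfolding FS by auto
  show ?thesis
    unfolding has_excess_def
  proof (intro exI[of _ "bs @ x # A0 @ a # b # B0"] exI[of _ "k + 1 + f"] conjI allI impI)
    show "chain ((bs @ x # A0 @ a # b # B0) @ [c (Suc j)])"
      using bk(1,2) xF chS unfolding x_def[symmetric] y_def[symmetric] by auto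
    show "set (bs @ x # A0 @ a # b # B0) \<subseteq> set (prefix (Suc j))"
      using bk(2) xF unfolding FS by auto
    show "bs @ x # A0 @ a # b # B0 \<noteq> []" by simp
  next
    fix a' b' p
    assume e: "(a', b') \<in> edges ((bs @ x # A0 @ a # b # B0) @ [c (Suc j)])" and p: "p \<in> V" "wedge a' b' p"
    have "edges (x # A0 @ [a]) \<subseteq> edges (prefix m)"
      using block_edges[of i] ij edges_append[of "x # A0" a "[hd C]"] by (auto simp: a C x_def)
    moreover have "edges (b # B0 @ [y]) \<subseteq> edges (prefix m)"
      using block_edges[of j] ij by (auto simp: b y_def)
    moreover have "edges ((bs @ x # A0 @ a # b # B0) @ [c (Suc j)]) =
        edges (bs @ [x]) \<union> edges (x # A0 @ [a]) \<union> insert (a, b) (edges (b # B0 @ [y]))"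
      using edges_append[of bs x "A0 @ a # b # B0 @ [y]"] edges_append[of "x # A0" a "b # B0 @ [y]"]
      by (simp add: y_def Un_assoc)
    ultimately consider "(a', b') \<in> edges (bs @ [x])" | "(a', b') \<in> edges (prefix m)" | "a' = a" "b' = b"
      using e by auto
    then show "det2 a' b' \<le> det2 a' p + det2 p b'"
    proof cases
      case 3
      have "p \<in> set (a # C @ [b])"
      proof -
        have "\<forall>u\<in>set (M @ x # A0). 0 < det2 u a" "\<forall>u\<in>set (B0 @ y # be). 0 < det2 b u"
          using chM by auto
        moreover have "\<not> 0 < det2 p a" "\<not> 0 < det2 b p"
          using p(2) 3 by (simp_all add: wedge_def det2_swap[of p a] det2_swap[of b p])
        ultimately have "p \<notin> set (M @ x # A0)" "p \<notin> set (B0 @ y # be)"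
          by blast+
        then show ?thesis using p(1) unfolding VM by auto
      qed
      then show ?thesis using bypass_above[OF hyp, of p] 3 by auto
    qed (use bk(3) edge_bound p x_def in auto)
  next
    have "valley_count ((bs @ x # A0 @ a # b # B0) @ c (Suc j) # next_point (Suc j)) =
        valley_count (bs @ x # next_point i) + valley_count (x # A0 @ a # b # B0 @ y # next_point (Suc j))"
      using ij valley_count_append[of bs x "hd (A0 @ [a])" "tl (A0 @ a # b # B0 @ y # next_point (Suc j))"]
      by (cases A0) (auto simp: next_point_def a y_def)
    moreover have "valley_count (x # A0 @ a # b # B0 @ y # next_point (Suc j)) + f \<le> length A0 + length B0 + 2"
      using bypass_valley_count[OF hyp, of "next_point (Suc j)"] peak[of j] by (auto simp: next_point_def b y_def f_def)
    moreover have "length (prefix (Suc j)) = length (prefix i) + length A0 + length B0 + (j - i) + 3"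
      unfolding FS using C(4) by simp
    ultimately show "3 * (int (valley_count ((bs @ x # A0 @ a # b # B0) @ c (Suc j) # next_point (Suc j))) + int (k + 1 + f) + int (Suc j) + 1)
      \<le> 4 * int (length (prefix (Suc j))) - 1 + (v - (int j - int i))"
      using bk(4) ij unfolding x_def[symmetric] by (simp add: of_nat_diff)
  next
    fix r N
    assume det2': "chain (prefix (Suc j) @ r)" and rV: "set r \<subseteq> V"
      and p: "partition_under V N ((bs @ x # A0 @ a # b # B0) @ c (Suc j) # r)"
    have ch: "chain (prefix i @ A0 @ a # C @ b # B0 @ y # r)" using det2' unfolding FS by simp
    have ch1: "chain (prefix i @ A0 @ a # b # B0 @ y # r)" using ch by auto
    have "set (A0 @ a # b # B0 @ y # r) \<subseteq> V" using rV hyp1 by simp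
    moreover have "partition_under V N (bs @ c i # A0 @ a # b # B0 @ y # r)"
      using p by (simp add: x_def y_def)
    ultimately have q1: "partition_under V (N + k) (map c [0..<i] @ x # A0 @ a # b # B0 @ y # r)"
      using bk(5)[OF ch1] unfolding x_def by blast
    have q2: "chain (map c [0..<i] @ x # A0 @ a # C @ b # B0 @ y # r)"
      using peaks_chain_append[OF _ ch] ij by (simp add: x_def)
    have "partition_under V (N + k + 1 + f) (map c [0..<i] @ x # C @ y # r)"
      using bypass_partition[OF hyp q1 q2] unfolding f_def by (simp only: add.assoc)
    moreover have "map c [0..<i] @ x # C @ y # r = map c [0..<Suc j] @ y # r"
      using arg_cong[OF iC, of "\<lambda>l. l @ y # r"] by (simp only: append_assoc append_Cons)
    ultimately show "partition_under V (N + (k + 1 + f)) (map c [0..<Suc j] @ c (Suc j) # r)"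
      by (simp only: add.assoc y_def)
  qed
qed

text \<open>Removing valleys only enlarges the region, and at the start every point is a vertex.\<close>

lemma dominated_peaks: "V \<subseteq> under (map c [0..<Suc m])"
proof -
  have "V \<subseteq> under (map c [0..<j] @ c j # blocks c A j m)" if "j \<le> m" for j
    using that
  proof (induction j)
    case 0
    obtain W y where W: "blocks c A 0 m = W @ [y]"
      using m blocks_Suc[of 0 "m - 1" c A] by auto
    have "v \<in> under (c 0 # W @ [y])" if "v \<in> V" for v
      using that chain V unfolding W by (intro under_vertex) auto
    then show ?case using W by auto
  next
    case (Suc j)
    have e: "blocks c A j m = A j @ c (Suc j) # blocks c A (Suc j) m"
      using blocks_Cons[of j m c A] Suc.prems by simp
    have "chain (prefix j @ blocks c A j m)" using prefix_split[of j] chain Suc.prems by simp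
    then have "chain (map c [0..<j] @ c j # A j @ c (Suc j) # blocks c A (Suc j) m)"
      using peaks_chain_append[of j "blocks c A j m"] Suc.prems unfolding e by simp
    then have "under (map c [0..<j] @ c j # A j @ c (Suc j) # blocks c A (Suc j) m)
       \<subseteq> under (map c [0..<j] @ c j # c (Suc j) # blocks c A (Suc j) m)"
      using valley[of j] Suc.prems by (intro under_cut_valley) auto
    then show ?case using Suc unfolding e by auto
  qed
  from this[of m] show ?thesis by simp
qed

definition "peak_valley k \<longleftrightarrow> turn (c (k - 1)) (c k) (c (Suc k)) < 0"

lemma marked_pairs_peaks:
  "valley_pairs (map c [0..<Suc (Suc j)]) = marked_pairs peak_valley j"
proof (induction j)
  case (Suc j)
  show ?case
  proof (cases j)
    case (Suc i)
    have "valley_pairs (map c [0..<Suc (Suc (Suc j))]) =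
      valley_pairs (map c [0..<i] @ [c i, c (Suc i), c (Suc (Suc i)), c (Suc (Suc (Suc i)))])"
      by (simp add: Suc)
    also have "\<dots> = valley_pairs (map c [0..<Suc (Suc j)]) +
       (if peak_valley j \<and> peak_valley (Suc j) then 1 else 0)"
      unfolding valley_pairs_snoc by (simp add: Suc peak_valley_def)
    finally show ?thesis using Suc.IH Suc by simp
  qed simp
qed simp

lemma has_excess_end: "\<exists>v. has_excess m v \<and> v \<le> 2 + 3 * int (marked_pairs peak_valley (m - 1))"
proof -
  have adj: "has_excess (Suc j) (v - 1)" if "j < m" "\<not> A j \<noteq> []" "has_excess j v" for j v
    using has_excess_block[OF that(1,3)] that(2) by simp
  have one: "has_excess (Suc j) (v + 1)" if "j < m" "A j \<noteq> []" "has_excess j v" for j v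
    using has_excess_block[OF that(1,3)] that(2) by simp
  have two: "has_excess (Suc j) (v - (int j - int i))"
    if "i < j" "j < m" "A i \<noteq> []" "A j \<noteq> []" "\<And>k. i < k \<Longrightarrow> k < j \<Longrightarrow> \<not> A k \<noteq> []"
      "\<And>k. i < k \<Longrightarrow> k \<le> j \<Longrightarrow> \<not> peak_valley k" "has_excess i v" for i j v
    using that(5,6) unfolding peak_valley_def not_not
    by (intro has_excess_bypass[OF that(1-4) _ _ that(7)]) blast+
  show ?thesis
    by (rule gap_scan[where gap = "\<lambda>j. A j \<noteq> []", OF has_excess_start adj one two m])
qed

text \<open>The bottom chain found by the scan is cut into slabs, pushed up to the chain of peaks, and then relieved
  of its valleys, first run by run and then by triangles.\<close>

lemma hull_partition:
  "\<exists>L M. chain L \<and> bent 1 L \<and> set L \<subseteq> V \<and> V \<subseteq> under L \<and> 2 \<le> length L \<and> partition_under V M L \<and>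
     3 * (M + length L) \<le> 4 * card V + 4"
proof -
  obtain v where v: "has_excess m v" "v \<le> 2 + 3 * int (marked_pairs peak_valley (m - 1))"
    using has_excess_end by blast
  obtain bs k where bk: "chain (bs @ [c m])" "set bs \<subseteq> set (prefix m)" "bs \<noteq> []"
    "\<And>a b p. (a, b) \<in> edges (bs @ [c m]) \<Longrightarrow> p \<in> V \<Longrightarrow> wedge a b p \<Longrightarrow> det2 a b \<le> det2 a p + det2 p b"
    "3 * (int (valley_count (bs @ [c m])) + int k + int m + 1) \<le> 4 * int (length (prefix m)) - 1 + v"
    "\<And>r N. chain (prefix m @ r) \<Longrightarrow> set r \<subseteq> V \<Longrightarrow> partition_under V N (bs @ c m # r) \<Longrightarrow>
       partition_under V (N + k) (map c [0..<m] @ c m # r)"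
    using v(1) m unfolding has_excess_def next_point_def by auto
  have "set (bs @ [c m]) \<subseteq> V" using bk(2) prefix_chain[of m] peaks_V[of m] by auto
  moreover have "2 \<le> length (bs @ [c m])" using bk(3) by (cases bs) auto
  ultimately have "partition_under V (Suc (valley_count (bs @ [c m]))) (bs @ [c m])"
    using bk(1,4) by (intro partition_slabs[OF no_three]) auto
  then have "partition_under V (Suc (valley_count (bs @ [c m])) + k) (map c [0..<m] @ c m # [])"
    using bk(6)[of "[]" "Suc (valley_count (bs @ [c m]))"] chain by simp
  then have p: "partition_under V (Suc (valley_count (bs @ [c m])) + k) (map c [0..<Suc m])" by simp
  have K: "map c [0..<Suc m] = [] @ c 0 # map c [Suc 0..<Suc m]"
    by (simp add: upt_conv_Cons del: upt_Suc)
  have sK: "set (map c [0..<Suc m]) \<subseteq> V" using peaks_subset[of m] prefix_chain[of m] by blast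
  obtain L M where L: "chain ([] @ c 0 # L)" "set L \<subseteq> set (map c [Suc 0..<Suc m])" "L \<noteq> []"
    "V \<subseteq> under ([] @ c 0 # L)" "partition_under V M ([] @ c 0 # L)"
    "M + length L + valley_pairs (c 0 # map c [Suc 0..<Suc m]) =
       (Suc (valley_count (bs @ [c m])) + k) + length (map c [Suc 0..<Suc m])"
    using merge_valleys[OF peaks_chain[of m, unfolded K] sK[unfolded K] dominated_peaks[unfolded K] p[unfolded K]] m
    by auto
  have "valley_pairs (c 0 # map c [Suc 0..<Suc m]) = marked_pairs peak_valley (m - 1)"
    using marked_pairs_peaks[of "m - 1"] K m by simp
  then have cnt: "M + length L + marked_pairs peak_valley (m - 1) = Suc (valley_count (bs @ [c m])) + k + m"
    using L(6) by simp
  have sL: "set (c 0 # L) \<subseteq> V" using L(2) sK[unfolded K] by (auto simp del: upt_Suc set_upt)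
  have "2 \<le> length (c 0 # L)" using L(3) by (cases L) auto
  then obtain L' M' where L': "chain L'" "bent 1 L'" "set L' \<subseteq> set (c 0 # L)" "V \<subseteq> under L'"
     "2 \<le> length L'" "partition_under V M' L'" "M' + length L' = M + length (c 0 # L)"
    using triangulate_valleys[OF no_three, of "c 0 # L" M] L(1,4,5) sL by auto
  have "card V = length (prefix m)"
    unfolding V by (rule distinct_card[OF chain_distinct[OF chain]])
  then have "3 * (M' + length L') \<le> 4 * card V + 4"
    using bk(5) v(2) cnt L'(7) by simp
  then show ?thesis using L' sL by blast
qed

end

section \<open>From the origin to an arbitrary hull vertex\<close>

lemma vertices_translation: "vertices ((+) p ` Q) = (+) p ` vertices Q"
proof -
  have "x extreme_point_of Q \<Longrightarrow> p + x extreme_point_of (+) p ` Q" for p x :: pt and Q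
    using extreme_point_of_translation_eq[of p x Q] by simp
  moreover have "y extreme_point_of (+) p ` Q \<Longrightarrow> y - p extreme_point_of Q" for y
    using extreme_point_of_translation_eq[of p "y - p" Q] by simp
  ultimately show ?thesis
    unfolding vertices_def by (force intro: image_eqI[of _ _ "_ - p"])
qed

lemma convex_decomposition_translation:
  assumes "convex_decomposition S D"
  shows "convex_decomposition ((+) p ` S) ((`) ((+) p) ` D)"
proof -
  have D: "\<And>Q. Q \<in> D \<Longrightarrow> polytope Q \<and> interior Q \<noteq> {} \<and> vertices Q \<subseteq> S \<and> S \<inter> interior Q = {}"
    "pairwise (\<lambda>Q R. interior Q \<inter> interior R = {}) D" "\<Union>D = convex hull S"
    using assms unfolding convex_decomposition_def convex_polygon_def by auto
  have poly: "polytope ((+) p ` Q)" if "polytope Q" for Q :: "pt set"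
    using that unfolding polytope_def by (metis convex_hull_translation finite_imageI)
  have dis: "(+) p ` X \<inter> (+) p ` Y = {}" if "X \<inter> Y = {}" for X Y :: "pt set"
    using that by auto
  show ?thesis
    unfolding convex_decomposition_def convex_polygon_def
  proof (intro conjI ballI)
    fix Q assume "Q \<in> (`) ((+) p) ` D"
    then obtain R where R: "Q = (+) p ` R" "R \<in> D" by blast
    show "polytope Q" using R D(1) poly by blast
    show "interior Q \<noteq> {}" using R D(1)[of R] by (simp add: interior_translation)
    show "vertices Q \<subseteq> (+) p ` S" using R D(1)[of R] by (auto simp: vertices_translation)
    show "(+) p ` S \<inter> interior Q = {}"
      using D(1)[of R] R dis[of S "interior R"] by (simp add: interior_translation)
  next
    show "pairwise (\<lambda>Q R. interior Q \<inter> interior R = {}) ((`) ((+) p) ` D)"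
    proof (rule pairwiseI)
      fix X Y assume "X \<in> (`) ((+) p) ` D" "Y \<in> (`) ((+) p) ` D" "X \<noteq> Y"
      then obtain Q R where "X = (+) p ` Q" "Y = (+) p ` R" "Q \<in> D" "R \<in> D" "Q \<noteq> R" by blast
      then show "interior X \<inter> interior Y = {}"
        using dis[of "interior Q" "interior R"] pairwiseD[OF D(2), of Q R]
        by (simp add: interior_translation)
    qed
    have "\<Union>((`) ((+) p) ` D) = (+) p ` \<Union>D" by auto
    then show "\<Union>((`) ((+) p) ` D) = convex hull ((+) p ` S)"
      by (simp add: D(3) convex_hull_translation)
  qed
qed

lemma boundary_points_translation: "boundary_points ((+) p ` S) = (+) p ` boundary_points S"
  by (auto simp: boundary_points_def convex_hull_translation vertices_translation)

text \<open>A linear functional \<open>h\<close> that is positive on \<open>V\<close> exists by separation. The slope \<open>det2 h x / h x\<close> then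
  increases with the angle.\<close>

lemma angular_order:
  assumes "finite V" "no_three (insert 0 V)" "0 \<notin> convex hull V"
  shows "\<exists>xs. set xs = V \<and> chain xs"
proof -
  have "closed (convex hull V)"
    using assms(1) by (intro compact_imp_closed finite_imp_compact_convex_hull)
  then obtain h b where h: "0 < b" "\<And>x. x \<in> convex hull V \<Longrightarrow> b < inner h x"
    using separating_hyperplane_closed_0[of "convex hull V"] assms(3) by auto
  have pos: "0 < inner h x" if "x \<in> V" for x
    using h(2)[of x] h(1) hull_inc[OF that, of convex] by linarith
  define key where "key x = det2 h x / inner h x" for x
  obtain ys where ys: "set ys = V" "distinct ys" using finite_distinct_list[OF assms(1)] by blast
  define xs where "xs = sort_key key ys"
  have xs: "set xs = V" "distinct xs" "sorted (map key xs)" using ys by (auto simp: xs_def)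
  have det2_pos: "0 < det2 u v" if uv: "u \<in> V" "v \<in> V" "u \<noteq> v" "key u \<le> key v" for u v
  proof -
    have "u \<noteq> 0" "v \<noteq> 0" using pos[OF uv(1)] pos[OF uv(2)] by auto
    then have "turn 0 u v \<noteq> 0"
      using assms(2)[unfolded no_three_def, rule_format, of 0 u v] uv by simp
    then have nz: "det2 u v \<noteq> 0" by (simp add: turn_def)
    have "det2 h u * inner h v \<le> det2 h v * inner h u"
      using uv(4) pos[OF uv(1)] pos[OF uv(2)]
      by (simp add: key_def pos_divide_le_eq pos_le_divide_eq mult.commute)
    \<comment> \<open>In the orthogonal frame given by \<open>h\<close>, the determinant of \<open>u\<close> and \<open>v\<close> compares their slopes.\<close>
    moreover have "det2 h v * inner h u - det2 h u * inner h v = inner h h * det2 u v"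
      by (simp add: det2_def inner_vec_def sum_2) algebra
    ultimately have "0 \<le> inner h h * det2 u v" by simp
    moreover have "0 < inner h h" using pos[OF uv(1)] by (auto simp: inner_gt_zero_iff)
    ultimately show ?thesis using nz by (simp add: zero_le_mult_iff)
  qed
  have "chain xs"
    unfolding chain_def sorted_wrt_iff_nth_less
  proof (intro allI impI)
    fix i j assume ij: "i < j" "j < length xs"
    have "key (xs ! i) \<le> key (xs ! j)"
      using sorted_nth_mono[OF xs(3), of i j] ij by simp
    moreover have "xs ! i \<noteq> xs ! j" using xs(2) ij by (simp add: nth_eq_iff_index_eq)
    moreover have "xs ! i \<in> V" "xs ! j \<in> V" using ij unfolding xs(1)[symmetric] by simp_all
    ultimately show "0 < det2 (xs ! i) (xs ! j)" by (simp add: det2_pos)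
  qed
  then show ?thesis using xs(1) by blast
qed

text \<open>The last chain and the origin contain all extreme points, which bounds the number of boundary points
  by one more than its length.\<close>

lemma decomposition_at_origin:
  assumes V: "finite V" "no_three (insert 0 V)" "0 \<notin> convex hull V" "2 \<le> card V"
  shows "\<exists>D. convex_decomposition (insert 0 V) D \<and>
     3 * card D + 3 * card (boundary_points (insert 0 V)) \<le> 4 * card V + 7"
proof -
  obtain xs where xs: "set xs = V" "chain xs" using angular_order[OF V(1-3)] by blast
  have "2 \<le> length xs" using V(4) card_length[of xs] unfolding xs(1) by (rule order_trans)
  then obtain x K where K: "xs = x # K" "K \<noteq> []" by (cases xs; cases "tl xs") auto
  obtain c A m where b: "0 < m" "c 0 = x" "K = blocks c A 0 m"
    "\<forall>j<m. bent (-1) (c j # A j @ [c (Suc j)])"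
    "\<forall>j. Suc j < m \<longrightarrow> \<not> turn (last (c j # A j)) (c (Suc j)) (hd (A (Suc j) @ [c (Suc (Suc j))])) < 0"
    using parse_blocks[OF K(2), of x] by blast
  have "no_three V" using V(2) by (simp add: no_three_def)
  then interpret valley_blocks V c A m
    using b xs K by unfold_locales auto
  obtain L M where L: "chain L" "bent 1 L" "set L \<subseteq> V" "V \<subseteq> under L" "2 \<le> length L"
    "partition_under V M L" "3 * (M + length L) \<le> 4 * card V + 4"
    using hull_partition by blast
  obtain u W w where LW: "L = u # W @ [w]"
  proof -
    obtain u L1 where "L = u # L1" "L1 \<noteq> []" using L(5) by (cases L; cases "tl L") auto
    then show thesis using that[of u "butlast L1" "last L1"] by simp
  qed
  have hL: "under L = convex hull (insert 0 (set L))"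
    using under_fan[of u W w] L(1,2) unfolding LW by simp
  have hull: "convex hull (insert 0 V) = convex hull (insert 0 (set L))"
  proof
    show "convex hull (insert 0 V) \<subseteq> convex hull (insert 0 (set L))"
    proof (rule hull_minimal)
      have "0 \<in> convex hull (insert 0 (set L))" by (rule hull_inc) simp
      then show "insert 0 V \<subseteq> convex hull (insert 0 (set L))" using L(4) unfolding hL by blast
    qed (rule convex_convex_hull)
    show "convex hull (insert 0 (set L)) \<subseteq> convex hull (insert 0 V)"
      using L(3) by (intro hull_mono) auto
  qed
  obtain D where D: "finite D" "card D \<le> M"
     "\<forall>Q\<in>D. interior Q \<noteq> {} \<and> (\<exists>T \<subseteq> insert 0 V. Q = convex hull T) \<and> insert 0 V \<inter> interior Q = {}"
     "pairwise (\<lambda>Q R. interior Q \<inter> interior R = {}) D" "\<Union>D = under L"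
    using L(6) unfolding partition_under_def by blast
  have dec: "convex_decomposition (insert 0 V) D"
    unfolding convex_decomposition_def convex_polygon_def
  proof (intro conjI ballI)
    fix Q assume Q: "Q \<in> D"
    then obtain T where T: "T \<subseteq> insert 0 V" "Q = convex hull T" using D(3) by blast
    have "finite T" using T(1) V(1) finite_subset by blast
    then show "polytope Q" unfolding polytope_def T(2) by blast
    show "vertices Q \<subseteq> insert 0 V"
      unfolding vertices_def T(2) using T(1) extreme_point_of_convex_hull by blast
    show "interior Q \<noteq> {}" "insert 0 V \<inter> interior Q = {}" using D(3)[rule_format, OF Q] by auto
  next
    show "pairwise (\<lambda>Q R. interior Q \<inter> interior R = {}) D" by (rule D(4))
    show "\<Union>D = convex hull (insert 0 V)" by (simp only: D(5) hL hull)
  qed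
  have "boundary_points (insert 0 V) \<subseteq> insert 0 (set L)"
    unfolding boundary_points_def vertices_def hull using extreme_point_of_convex_hull by blast
  then have "card (boundary_points (insert 0 V)) \<le> card (insert 0 (set L))"
    by (rule card_mono[rotated]) simp
  also have "\<dots> \<le> Suc (length L)"
    using card_length[of L] by (simp add: card_insert_if)
  finally have bd: "card (boundary_points (insert 0 V)) \<le> Suc (length L)" .
  have "3 * card D + 3 * card (boundary_points (insert 0 V)) \<le> 4 * card V + 7"
    using D(2) L(7) bd by presburger
  then show ?thesis using dec by blast
qed

theorem theorem1:
  fixes P :: "(real^2) set"
  assumes "finite P" and "card P \<ge> 3" and "general_position P"
  shows "real (min_decomposition P) \<le>
           4 / 3 * real (card (interior_points P)) + 1 / 3 * real (card (boundary_points P)) + 1"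
proof -
  have "P \<noteq> {}" using assms(2) by auto
  then obtain p where p: "p extreme_point_of (convex hull P)"
    using extreme_point_exists_convex[of "convex hull P"] finite_imp_compact_convex_hull[OF assms(1)]
      convex_convex_hull by (metis convex_hull_eq_empty)
  then have pP: "p \<in> P" by (rule extreme_point_of_convex_hull)
  have notin: "p \<notin> convex hull (P - {p})"
  proof
    assume "p \<in> convex hull (P - {p})"
    then have "convex hull P = convex hull (P - {p})"
      using hull_redundant[of p convex "P - {p}"] pP by (simp add: insert_absorb)
    then show False using p extreme_point_of_convex_hull[of p "P - {p}"] by auto
  qed
  define V where "V = (+) (- p) ` (P - {p})"
  have P2: "insert 0 V = (+) (- p) ` P"
    using pP unfolding V_def by (metis add.left_inverse image_insert insert_Diff)
  have P1: "P = (+) p ` insert 0 V"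
    unfolding P2 by (simp add: image_image)
  note P = P1 P2
  have V: "finite V" "card V = card P - 1"
    using assms(1) pP unfolding V_def by (simp_all add: card_image)
  have "convex hull V = (+) (- p) ` (convex hull (P - {p}))"
    unfolding V_def by (rule convex_hull_translation)
  then have V0: "0 \<notin> convex hull V" using notin by auto
  have V2: "2 \<le> card V" using V(2) assms(2) by linarith
  have nt: "no_three (insert 0 V)"
  proof -
    have "turn (- p + a) (- p + b) (- p + c) = turn a b c" for a b c
      by (simp add: turn_eq_det2)
    then show ?thesis
      using assms(3) unfolding no_three_def general_position_def P(2) ball_simps
      by (simp add: turn_zero_iff)
  qed
  obtain D where D: "convex_decomposition (insert 0 V) D"
    "3 * card D + 3 * card (boundary_points (insert 0 V)) \<le> 4 * card V + 7"
    using decomposition_at_origin[OF V(1) nt V0 V2] by blast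
  define E where "E = (`) ((+) p) ` D"
  have "convex_decomposition P E"
    using convex_decomposition_translation[OF D(1), of p] P(1) by (simp add: E_def)
  then have "min_decomposition P \<le> card E"
    unfolding min_decomposition_def by (intro Least_le) blast
  also have "card E \<le> card D"
    unfolding E_def using convex_decomposition_finite[OF _ D(1)] V(1) by (intro card_image_le) auto
  finally have m: "min_decomposition P \<le> card D" .
  have "card (boundary_points P) = card (boundary_points (insert 0 V))"
    using boundary_points_translation[of p "insert 0 V"] P(1) by (simp add: card_image)
  moreover have "boundary_points P \<subseteq> P" by (auto simp: boundary_points_def)
  then have "card P = card (interior_points P) + card (boundary_points P)"
    unfolding interior_points_def using assms(1)
    by (metis add.commute card_Diff_subset card_mono finite_subset le_add_diff_inverse)
  ultimately have "3 * min_decomposition P \<le> 4 * card (interior_points P) + card (boundary_points P) + 3"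
    using D(2) V(2) m assms(2) by linarith
  then have "3 * real (min_decomposition P) \<le> 4 * real (card (interior_points P)) + real (card (boundary_points P)) + 3"
    by linarith
  then show ?thesis by simp
qed

end
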